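(* Let $I$ be a finite set with $\#I\ge2$, let $0<\overline{\alpha}<1$, and suppose that for each $i\in I$ there is an invertible matrix $A_i\in\mathbb{R}^{d\times d}$ with $\|A_i\|\le\overline{\alpha}$. Suppose $K\subset I^\infty$ is a nonempty compact set with $\sigma(K)\subset K$, $t\in(0,d)\setminus\mathbb{N}$, and $c\ge1$. If $\mu\in\mathcal{E}_\sigma(K)$ satisfies $\mu([\mathtt{i}])\ge c^{-1}e^{-|\mathtt{i}|P_K(t)}\varphi^t(A_{\mathtt{i}})$ for all $\mathtt{i}\in K_*$, then $P_K$ is differentiable at $t$ and $$P_K'(t)=\lambda_{l+1}(\mu),$$ where $l=\lfloor t\rfloor$.
   Context: $I^\infty=I^{\mathbb{N}}$ carries the (compact, metrizable) product topology of the discrete set $I$, and $\sigma(i_1,i_2,\ldots)=(i_2,i_3,\ldots)$ is the left shift. For $\mathtt{i}\in I^\infty$, $\mathtt{i}|_n\in I^n$ is its initial word of length $n$; for $\mathtt{i}\in I^n$, $|\mathtt{i}|=n$, $[\mathtt{i}]=\{\mathtt{j}\in I^\infty:\mathtt{j}|_n=\mathtt{i}\}$ is the cylinder and $A_{\mathtt{i}}=A_{i_1}\cdots A_{i_n}$. For $K\subset I^\infty$, $K_n=\{\mathtt{i}|_n:\mathtt{i}\in K\}$ and $K_*=\bigcup_{n=1}^\infty K_n$. $\|\cdot\|$ is the Euclidean operator norm and $\alpha_1(A)\ge\cdots\ge\alpha_d(A)>0$ are the singular values of an invertible $A\in\mathbb{R}^{d\times d}$. The singular value function is $\varphi^t(A)=\alpha_1(A)\cdots\alpha_l(A)\,\alpha_{l+1}(A)^{t-l}$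 for $0\le t<d$, $l=\lfloor t\rfloor$, and $\varphi^t(A)=|\det A|^{t/d}$ for $t\ge d$. For nonempty $K$ with $\sigma(K)\subset K$, the topological pressure is $P_K(t)=\lim_{n\to\infty}\frac1n\log\sum_{\mathtt{i}\in K_n}\varphi^t(A_{\mathtt{i}})$, $t\ge0$ (the limit exists by subadditivity). $\mathcal{M}_\sigma(K)$ is the set of $\sigma$-invariant Borel probability measures on $I^\infty$ whose support is contained in $K$, and $\mathcal{E}_\sigma(K)$ is the set of those $\mu\in\mathcal{M}_\sigma(K)$ that are ergodic with respect to $\sigma$. For $\mu\in\mathcal{M}_\sigma(K)$ and $m\in\{1,\ldots,d\}$, $\lambda_m(\mu)=\lim_{n\to\infty}\frac1n\sum_{\mathtt{i}\in K_n}\mu([\mathtt{i}])\log\alpha_m(A_{\mathtt{i}})$ (the limit exists). *)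

theory Defs
  imports "HOL-Probability.Probability" "HOL-Library.Multiset"
begin

definition eigenspace :: "real^'n^'n \<Rightarrow> real \<Rightarrow> (real^'n) set" where
  "eigenspace B e = {x. B *v x = e *\<^sub>R x}"

definition eigenvalues :: "real^'n^'n \<Rightarrow> real set" where
  "eigenvalues B = {e. \<exists>x\<in>eigenspace B e. x \<noteq> 0}"

text \<open>
  The singular values of \<open>A\<close> are the square roots of the eigenvalues of \<open>A\<^sup>T A\<close>, repeated
  according to multiplicity and listed in decreasing order. As \<open>A\<^sup>T A\<close> is symmetric, the
  multiplicity of an eigenvalue is the dimension of its eigenspace.
\<close>

definition singular_values :: "real^'n^'n \<Rightarrow> real list" where
  "singular_values A =
     (let B = transpose A ** A
      in rev (sorted_list_of_multiset
           (\<Sum>e\<in>eigenvalues B. replicate_mset (dim (eigenspace B e)) (sqrt e))))"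

text \<open>\<open>singular_value m A\<close> is \<open>\<alpha>\<^sub>m(A)\<close> and is meaningful for \<open>1 \<le> m \<le> d\<close>.\<close>

definition singular_value :: "nat \<Rightarrow> real^'n^'n \<Rightarrow> real" where
  "singular_value m A = singular_values A ! (m - 1)"

definition singular_value_function :: "real \<Rightarrow> real^'n^'n \<Rightarrow> real" where
  "singular_value_function t A =
     (if t < real CARD('n)
      then (let l = nat \<lfloor>t\<rfloor>
            in (\<Prod>m = 1..l. singular_value m A) * singular_value (l + 1) A powr (t - real l))
      else \<bar>det A\<bar> powr (t / real CARD('n)))"

text \<open>
  A point \<open>(i\<^sub>1, i\<^sub>2, \<dots>)\<close> of \<open>I\<^sup>\<infinity>\<close> is a function \<open>nat \<Rightarrow> 'i\<close> with \<open>i\<^sub>k\<close> its value at \<open>k - 1\<close>;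
  for \<open>'i\<close> of class \<open>discrete_topology\<close> the library's topology on this function type is
  the product of discrete topologies. Finite words are lists.
\<close>

definition left_shift :: "(nat \<Rightarrow> 'i) \<Rightarrow> nat \<Rightarrow> 'i" where
  "left_shift x = (\<lambda>n. x (Suc n))"

definition initial_word :: "nat \<Rightarrow> (nat \<Rightarrow> 'i) \<Rightarrow> 'i list" where
  "initial_word n x = map x [0..<n]"

definition cylinder :: "'i list \<Rightarrow> (nat \<Rightarrow> 'i) set" where
  "cylinder w = {x. initial_word (length w) x = w}"

definition words_of_length :: "(nat \<Rightarrow> 'i) set \<Rightarrow> nat \<Rightarrow> 'i list set" where
  "words_of_length K n = initial_word n ` K"

definition words :: "(nat \<Rightarrow> 'i) set \<Rightarrow> 'i list set" where
  "words K = (\<Union>n\<in>{1..}. words_of_length K n)"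

definition word_matrix :: "('i \<Rightarrow> real^'n^'n) \<Rightarrow> 'i list \<Rightarrow> real^'n^'n" where
  "word_matrix A w = foldr (\<lambda>i M. A i ** M) w (mat 1)"

text \<open>
  For nonempty, shift-invariant \<open>K\<close>, invertible matrices and \<open>t \<ge> 0\<close> the limit exists by
  subadditivity; only \<open>t \<ge> 0\<close> is meaningful.
\<close>

definition pressure :: "('i \<Rightarrow> real^'n^'n) \<Rightarrow> (nat \<Rightarrow> 'i) set \<Rightarrow> real \<Rightarrow> real" where
  "pressure A K t =
     lim (\<lambda>n. 1 / real n *
       ln (\<Sum>w\<in>words_of_length K n. singular_value_function t (word_matrix A w)))"

definition measure_support :: "'a::topological_space measure \<Rightarrow> 'a set" where
  "measure_support \<mu> = {x. \<forall>U. open U \<longrightarrow> x \<in> U \<longrightarrow> emeasure \<mu> U > 0}"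

definition invariant_measures ::
    "(nat \<Rightarrow> 'i::topological_space) set \<Rightarrow> (nat \<Rightarrow> 'i) measure set" where
  "invariant_measures K =
     {\<mu>. prob_space \<mu> \<and> sets \<mu> = sets borel \<and>
         (\<forall>B\<in>sets borel. emeasure \<mu> (left_shift -` B) = emeasure \<mu> B) \<and>
         measure_support \<mu> \<subseteq> K}"

definition ergodic_measures ::
    "(nat \<Rightarrow> 'i::topological_space) set \<Rightarrow> (nat \<Rightarrow> 'i) measure set" where
  "ergodic_measures K =
     {\<mu>\<in>invariant_measures K.
        \<forall>B\<in>sets borel. left_shift -` B = B \<longrightarrow> emeasure \<mu> B = 0 \<or> emeasure \<mu> B = 1}"

definition lyapunov_exponent ::
    "('i \<Rightarrow> real^'n^'n) \<Rightarrow> (nat \<Rightarrow> 'i) set \<Rightarrow> nat \<Rightarrow> (nat \<Rightarrow> 'i) measure \<Rightarrow> real" where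
  "lyapunov_exponent A K m \<mu> =
     lim (\<lambda>n. 1 / real n *
       (\<Sum>w\<in>words_of_length K n.
          measure \<mu> (cylinder w) * ln (singular_value m (word_matrix A w))))"

end

theory Submission
  imports Defs
begin

text \<open>
  Let \<open>l = \<lfloor>t\<rfloor>\<close> and \<open>\<psi>\<^sub>k(A) = \<alpha>\<^sub>1(A) \<cdots> \<alpha>\<^sub>k(A)\<close>. For \<open>s\<close> between \<open>l\<close> and \<open>l + 1\<close> the singular value
  function is the geometric interpolation \<open>\<phi>\<^sup>s = (\<psi>\<^sub>l)\<^bsup>1-\<theta>\<^esup> (\<psi>\<^bsub>l+1\<^esub>)\<^sup>\<theta>\<close> with \<open>\<theta> = s - l\<close>, hence
  \<open>\<phi>\<^bsup>t+h\<^esup>(A\<^sub>w) = \<phi>\<^sup>t(A\<^sub>w) exp (h r(w))\<close> with \<open>r(w) = ln \<alpha>\<^bsub>l+1\<^esub>(A\<^sub>w)\<close>.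

  Write \<open>Z\<^sub>n(s)\<close> for the sum of \<open>\<phi>\<^sup>s(A\<^sub>w)\<close> over the words of length \<open>n\<close>, and \<open>P\<close> for the
  pressure. Submultiplicativity gives \<open>n P(s) \<le> ln Z\<^sub>n(s)\<close> for every \<open>n\<close>, not just in the
  limit. Summing the lower bound on \<open>\<mu>\<close> over all cylinders of length \<open>n\<close> gives the opposite
  estimate \<open>ln Z\<^sub>n(t) \<le> n P(t) + ln c\<close> at the single parameter \<open>t\<close>. Together,
  \<open>P(t + h) - P(t) \<le> (ln (\<Sum>w. m\<^sub>n(w) exp (h r(w))) + ln c) / n\<close> for all \<open>n\<close>, where
  \<open>m\<^sub>n = \<phi>\<^sup>t / Z\<^sub>n(t)\<close> are probability weights on words with \<open>m\<^sub>n \<le> c \<mu>\<close>. By ergodicity \<open>r(w)/n\<close>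
  converges to \<open>\<lambda> = \<lambda>\<^bsub>l+1\<^esub>(\<mu>)\<close> in mean with respect to \<open>\<mu>\<close>, and therefore also with respect to
  \<open>m\<^sub>n\<close>. Now let \<open>n\<close> depend on \<open>h\<close> so that \<open>n h\<close> stays close to a constant \<open>M\<close>: the
  exponents \<open>h r(w)\<close> are then bounded and concentrate at \<open>n h \<lambda>\<close>, and the right-hand side,
  divided by \<open>h\<close>, is at most \<open>\<lambda> + ln c / M + o(1)\<close>. As \<open>M\<close> is arbitrary, the upper right slope
  of \<open>P\<close> at \<open>t\<close> is at most \<open>\<lambda>\<close>; the same argument for negative \<open>h\<close> bounds the slope on the left.
  Finally \<open>2 P(t) \<le> P(t + h) + P(t - h)\<close> by Cauchy-Schwarz, so the two one-sided upper
  bounds bound each other from below and \<open>P'(t) = \<lambda>\<close>. The lemmas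
  \<open>concentration_slope_upper\<close>, \<open>has_real_derivative_of_slope_bounds\<close> and
  \<open>gibbs_pressure_derivative\<close> carry this out.

  Two ingredients remain. The products \<open>\<psi>\<^sub>k\<close> are submultiplicative
  (\<open>singular_product_mult_le\<close>): all singular values of both factors below the \<open>k\<close>-th are
  raised to the \<open>k\<close>-th, which keeps \<open>\<psi>\<^sub>k\<close> of each factor and does not decrease the singular
  values of the product, and then determinants are compared. The convergence in mean
  of \<open>r(w)/n\<close> comes from applying \<open>subadditive_mean_convergence\<close> to
  \<open>ln \<psi>\<^sub>l\<close> and to \<open>ln \<psi>\<^bsub>l+1\<^esub>\<close>. It rests on the maximal ergodic theorem, which bounds subadditive
  processes from above almost everywhere; together with convergence of the integrals this
  one-sided bound forces convergence in mean.
\<close>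

section \<open>Singular values of a matrix\<close>

text \<open>
  A maximiser of the Rayleigh quotient on the unit sphere of the invariant subspace is an
  eigenvector.
\<close>

lemma selfadjoint_eigenvector:
  fixes f :: "'a::euclidean_space \<Rightarrow> 'a"
  assumes f: "linear f" and sa: "\<And>x y. f x \<bullet> y = x \<bullet> f y"
    and S: "subspace S" "f ` S \<subseteq> S" "S \<noteq> {0}"
  shows "\<exists>v\<in>S. \<exists>e. norm v = 1 \<and> f v = e *\<^sub>R v"
proof -
  let ?U = "S \<inter> sphere 0 1"
  have "compact ?U" using closed_subspace[OF S(1)]
    by (metis compact_Int_closed compact_sphere inf_commute)
  moreover have "?U \<noteq> {}"
  proof -
    obtain x where x: "x \<in> S" "x \<noteq> 0" using S by (auto dest: subspace_0)
    then have "(1 / norm x) *\<^sub>R x \<in> ?U" using S(1) by (auto simp: subspace_scale)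
    then show ?thesis by blast
  qed
  moreover have "continuous_on ?U (\<lambda>x. x \<bullet> f x)"
    by (intro continuous_intros linear_continuous_on f linear_conv_bounded_linear[THEN iffD1])
  ultimately obtain v where v: "v \<in> ?U" and vmax: "\<And>x. x \<in> ?U \<Longrightarrow> x \<bullet> f x \<le> v \<bullet> f v"
    using continuous_attains_sup[of ?U "\<lambda>x. x \<bullet> f x"] by blast
  define e where "e = v \<bullet> f v"
  have quad: "y \<bullet> f y \<le> e * (y \<bullet> y)" if "y \<in> S" for y
  proof (cases "y = 0")
    case True then show ?thesis by (simp add: linear_0[OF f])
  next
    case False
    then have "(1 / norm y) *\<^sub>R y \<in> ?U" using that S(1) by (auto simp: subspace_scale)
    from vmax[OF this] have "(y \<bullet> f y) / (norm y)\<^sup>2 \<le> e"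
      by (simp add: linear_scale[OF f] e_def power2_eq_square)
    then show ?thesis using False by (simp add: field_simps power2_norm_eq_inner)
  qed
  define w where "w = f v - e *\<^sub>R v"
  have vS: "v \<in> S" and vv: "v \<bullet> v = 1" using v by (auto simp: dot_square_norm)
  have wS: "w \<in> S" unfolding w_def using vS S by (intro subspace_diff subspace_scale) auto
  \<comment> \<open>Perturb the maximiser in the direction \<open>w\<close>: the linear term \<open>2 s (w \<bullet> w)\<close> must vanish.\<close>
  have key: "2 * s * (w \<bullet> w) \<le> s\<^sup>2 * (e * (w \<bullet> w) - w \<bullet> f w)" for s
  proof -
    have "v + s *\<^sub>R w \<in> S" using vS wS S(1) by (intro subspace_add subspace_scale)
    from quad[OF this] have
      "e + 2 * s * (w \<bullet> f v) + s\<^sup>2 * (w \<bullet> f w) \<le> e * (1 + 2 * s * (w \<bullet> v) + s\<^sup>2 * (w \<bullet> w))"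
      using sa[of w v] vv
      by (simp add: linear_add[OF f] linear_scale[OF f] inner_add e_def power2_eq_square
          inner_commute algebra_simps)
    then have "2 * s * (w \<bullet> f v) + s\<^sup>2 * (w \<bullet> f w) \<le> e * (2 * s * (w \<bullet> v)) + s\<^sup>2 * (e * (w \<bullet> w))"
      by (simp add: algebra_simps)
    moreover have "w \<bullet> w = w \<bullet> f v - e * (w \<bullet> v)"
      by (subst (2) w_def) (simp add: inner_diff_right)
    then have "2 * s * (w \<bullet> w) = 2 * s * (w \<bullet> f v) - 2 * s * (e * (w \<bullet> v))"
      by (metis right_diff_distrib)
    ultimately show ?thesis by (simp add: algebra_simps)
  qed
  have "w \<bullet> w = 0"
  proof (rule ccontr)
    assume "w \<bullet> w \<noteq> 0"
    then have pos: "w \<bullet> w > 0" by simp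
    define b where "b = e * (w \<bullet> w) - w \<bullet> f w"
    \<comment> \<open>so small that the quadratic term \<open>s\<^sup>2 b\<close> stays below half of the linear one\<close>
    define s where "s = (w \<bullet> w) / (\<bar>b\<bar> + 1)"
    have s: "s > 0" using pos by (simp add: s_def)
    from key[of s] s have "2 * (w \<bullet> w) \<le> s * b" by (simp add: b_def power2_eq_square)
    also have "\<dots> \<le> s * (\<bar>b\<bar> + 1)" using s by (intro mult_left_mono) auto
    also have "\<dots> = w \<bullet> w" by (simp add: s_def)
    finally show False using pos by simp
  qed
  then have "f v = e *\<^sub>R v" by (simp add: w_def)
  then show ?thesis using v vS by auto
qed

text \<open>
  The orthogonal complement of an eigenvector inside an invariant subspace is again
  invariant, so eigenvectors can be split off one at a time.
\<close>

lemma selfadjoint_orthonormal_eigenbasis: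
  fixes f :: "'a::euclidean_space \<Rightarrow> 'a"
  assumes f: "linear f" and sa: "\<And>x y. f x \<bullet> y = x \<bullet> f y"
    and "subspace S" "f ` S \<subseteq> S"
  shows "\<exists>E\<subseteq>S. pairwise orthogonal E \<and> (\<forall>v\<in>E. norm v = 1 \<and> (\<exists>e. f v = e *\<^sub>R v)) \<and> span E = S"
  using assms(3,4)
proof (induction "dim S" arbitrary: S rule: less_induct)
  case less
  show ?case
  proof (cases "S = {0}")
    case True
    then show ?thesis by (intro exI[of _ "{}"]) auto
  next
    case False
    from selfadjoint_eigenvector[OF f sa less.prems this] obtain v e where
      v: "v \<in> S" "norm v = 1" "f v = e *\<^sub>R v" by blast
    have vv: "v \<bullet> v = 1" using v(2) by (simp add: dot_square_norm)
    define T where "T = S \<inter> {x. v \<bullet> x = 0}"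
    have T: "subspace T" unfolding T_def
      using less.prems by (intro subspace_inter subspace_hyperplane)
    have fT: "f ` T \<subseteq> T"
    proof
      fix y assume "y \<in> f ` T"
      then obtain x where x: "y = f x" "x \<in> S" "v \<bullet> x = 0" by (auto simp: T_def)
      have "v \<bullet> y = 0" using sa[of v x] x v by simp
      then show "y \<in> T" using x less.prems by (auto simp: T_def)
    qed
    have "v \<notin> T" using vv by (simp add: T_def)
    then have "T \<subset> S" using v(1) unfolding T_def by blast
    then have "dim T < dim S"
      using dim_psubset[of T S] T less.prems by (metis span_eq_iff)
    from less.hyps[OF this T fT] obtain E where
      E: "E \<subseteq> T" "pairwise orthogonal E" "\<forall>v\<in>E. norm v = 1 \<and> (\<exists>e. f v = e *\<^sub>R v)" "span E = T"
      by blast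
    have "span (insert v E) = S"
    proof
      show "span (insert v E) \<subseteq> S"
        using v E less.prems by (intro span_minimal) (auto simp: T_def)
      show "S \<subseteq> span (insert v E)"
      proof
        fix x assume x: "x \<in> S"
        have "x - (v \<bullet> x) *\<^sub>R v \<in> T"
          unfolding T_def using x v less.prems vv
          by (auto simp: inner_diff_right intro: subspace_diff subspace_scale)
        then have "x - (v \<bullet> x) *\<^sub>R v \<in> span E" using E by simp
        then show "x \<in> span (insert v E)" by (auto simp: span_insert)
      qed
    qed
    moreover have "pairwise orthogonal (insert v E)"
      using E by (auto simp: pairwise_insert orthogonal_def T_def inner_commute)
    moreover have "insert v E \<subseteq> S" using v E by (auto simp: T_def)
    moreover have "\<forall>v\<in>insert v E. norm v = 1 \<and> (\<exists>e. f v = e *\<^sub>R v)" using v E by auto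
    ultimately show ?thesis by blast
  qed
qed

text \<open>
  Bases are indexed by \<open>0, \<dots>, d - 1\<close> rather than by the index type of the vectors, so that
  they can be matched with the decreasing order of the singular values.
\<close>

definition orthonormal_frame :: "(nat \<Rightarrow> real^'n) \<Rightarrow> bool" where
  "orthonormal_frame v \<longleftrightarrow>
     (\<forall>i<CARD('n). \<forall>j<CARD('n). v i \<bullet> v j = (if i = j then 1 else 0))"

lemma orthonormal_frameD:
  assumes "orthonormal_frame (v :: nat \<Rightarrow> real^'n)" "i < CARD('n)" "j < CARD('n)"
  shows "v i \<bullet> v j = (if i = j then 1 else 0)"
  using assms by (simp add: orthonormal_frame_def)

lemma orthonormal_frame_independent:
  assumes v: "orthonormal_frame (v :: nat \<Rightarrow> real^'n)" and J: "J \<subseteq> {..<CARD('n)}"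
  shows "independent (v ` J)" "dim (span (v ` J)) = card J"
proof -
  have vJ: "v i \<bullet> v j = (if i = j then 1 else 0)" if "i \<in> J" "j \<in> J" for i j
    using orthonormal_frameD[OF v] that J by (auto simp: subset_iff)
  have inj: "inj_on v J"
    using vJ by (intro inj_onI) (metis zero_neq_one)
  have "pairwise orthogonal (v ` J)"
    using vJ by (auto simp: pairwise_def orthogonal_def)
  moreover have "0 \<notin> v ` J"
    using vJ by (metis imageE inner_zero_left zero_neq_one)
  ultimately show ind: "independent (v ` J)" by (rule pairwise_orthogonal_independent)
  show "dim (span (v ` J)) = card J"
    using ind inj by (simp add: dim_span dim_eq_card_independent card_image)
qed

lemma orthonormal_frame_expansion:
  assumes v: "orthonormal_frame (v :: nat \<Rightarrow> real^'n)"
  shows "x = (\<Sum>i<CARD('n). (v i \<bullet> x) *\<^sub>R v i)"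
proof -
  have "span (v ` {..<CARD('n)}) = UNIV"
    using orthonormal_frame_independent(2)[OF v, of "{..<CARD('n)}"] dim_eq_full[of "v ` {..<CARD('n)}"]
    by simp
  define y where "y = x - (\<Sum>i<CARD('n). (v i \<bullet> x) *\<^sub>R v i)"
  have "y \<bullet> v j = 0" if "j < CARD('n)" for j
    using that by (simp add: y_def inner_diff_left inner_sum_left orthonormal_frameD[OF v]
        inner_commute[of x] if_distrib cong: if_cong)
  note y = this
  have "orthogonal y z" if "z \<in> span (v ` {..<CARD('n)})" for z
    by (rule orthogonal_to_span[OF that]) (auto simp: orthogonal_def y)
  then have "orthogonal y y" using \<open>span _ = UNIV\<close> by blast
  then show ?thesis by (simp add: y_def orthogonal_def)
qed

text \<open>
  The frame \<open>v\<close> consists of right singular vectors of \<open>M\<close> for the singular values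
  \<open>g 0 \<ge> g 1 \<ge> \<dots>\<close>: the images \<open>M *v v i\<close> are orthogonal and have length \<open>g i\<close>. Stated by inner
  products, this is stable under composing \<open>M\<close> with a map that is diagonal in the frame.
\<close>

definition singular_frame :: "real^'n^'n \<Rightarrow> (nat \<Rightarrow> real^'n) \<Rightarrow> (nat \<Rightarrow> real) \<Rightarrow> bool" where
  "singular_frame M v g \<longleftrightarrow> orthonormal_frame v \<and>
     (\<forall>i<CARD('n). \<forall>j<CARD('n). (M *v v i) \<bullet> (M *v v j) = (if i = j then (g i)\<^sup>2 else 0)) \<and>
     (\<forall>i<CARD('n). 0 \<le> g i) \<and> (\<forall>j<CARD('n). \<forall>i\<le>j. g j \<le> g i)"

lemma norm_sum_orthogonal_sq:
  fixes n :: nat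
  assumes "\<And>i j. i < n \<Longrightarrow> j < n \<Longrightarrow> w i \<bullet> w j = (if i = j then b i else 0)"
  shows "(norm (\<Sum>i<n. c i *\<^sub>R w i))\<^sup>2 = (\<Sum>i<n. b i * (c i)\<^sup>2)"
proof -
  have "(norm (\<Sum>i<n. c i *\<^sub>R w i))\<^sup>2 = (\<Sum>i<n. \<Sum>j<n. c i * (c j * (w j \<bullet> w i)))"
    by (simp add: power2_norm_eq_inner inner_sum_left inner_sum_right sum_distrib_left)
  also have "\<dots> = (\<Sum>i<n. \<Sum>j<n. if j = i then c i * (c i * b i) else 0)"
    using assms by (intro sum.cong refl) auto
  also have "\<dots> = (\<Sum>i<n. b i * (c i)\<^sup>2)"
    by (intro sum.cong refl) (simp add: power2_eq_square)
  finally show ?thesis .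
qed

lemma orthonormal_frame_norm:
  assumes v: "orthonormal_frame (v :: nat \<Rightarrow> real^'n)"
  shows "(norm x)\<^sup>2 = (\<Sum>i<CARD('n). (v i \<bullet> x)\<^sup>2)"
  using norm_sum_orthogonal_sq[of "CARD('n)" v "\<lambda>_. 1" "\<lambda>i. v i \<bullet> x"] orthonormal_frameD[OF v]
    orthonormal_frame_expansion[OF v, of x] by simp

lemma singular_frame_norm:
  assumes "singular_frame M (v :: nat \<Rightarrow> real^'n) g"
  shows "(norm (M *v x))\<^sup>2 = (\<Sum>i<CARD('n). (g i)\<^sup>2 * (v i \<bullet> x)\<^sup>2)"
proof -
  have v: "orthonormal_frame v" using assms by (simp add: singular_frame_def)
  have "M *v x = (\<Sum>i<CARD('n). (v i \<bullet> x) *\<^sub>R (M *v v i))"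
    by (subst orthonormal_frame_expansion[OF v, of x])
      (simp add: linear_sum linear_scale matrix_vector_mul_linear)
  then show ?thesis
    using norm_sum_orthogonal_sq[of "CARD('n)" "\<lambda>i. M *v v i" "\<lambda>i. (g i)\<^sup>2" "\<lambda>i. v i \<bullet> x"] assms
    by (simp add: singular_frame_def)
qed

lemma gram_inner: "x \<bullet> ((transpose M ** M) *v y) = (M *v x) \<bullet> (M *v (y::real^'n))"
proof -
  have "(transpose M ** M) *v y = (M *v y) v* M"
    by (simp add: transpose_matrix_vector flip: matrix_vector_mul_assoc)
  then have "((transpose M ** M) *v y) \<bullet> x = (M *v y) \<bullet> (M *v x)"
    by (simp add: dot_lmul_matrix)
  then show ?thesis by (simp add: inner_commute)
qed

lemma singular_frame_eigenvector:
  assumes fr: "singular_frame M (v :: nat \<Rightarrow> real^'n) g" and j: "j < CARD('n)"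
  shows "(transpose M ** M) *v v j = (g j)\<^sup>2 *\<^sub>R v j"
proof -
  have v: "orthonormal_frame v" using fr by (simp add: singular_frame_def)
  have "(transpose M ** M) *v v j = (\<Sum>i<CARD('n). ((M *v v i) \<bullet> (M *v v j)) *\<^sub>R v i)"
    by (subst orthonormal_frame_expansion[OF v]) (simp add: gram_inner)
  also have "\<dots> = (\<Sum>i<CARD('n). if i = j then (g j)\<^sup>2 *\<^sub>R v j else 0)"
    using fr j by (intro sum.cong refl) (auto simp: singular_frame_def)
  finally show ?thesis using j by simp
qed

lemma singular_frame_eigenspace:
  assumes fr: "singular_frame M (v :: nat \<Rightarrow> real^'n) g"
  shows "eigenspace (transpose M ** M) e = span (v ` {i. i < CARD('n) \<and> (g i)\<^sup>2 = e})"
    (is "_ = span (v ` ?J)")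
proof
  have v: "orthonormal_frame v" using fr by (simp add: singular_frame_def)
  show "eigenspace (transpose M ** M) e \<subseteq> span (v ` ?J)"
  proof
    fix x assume "x \<in> eigenspace (transpose M ** M) e"
    then have x: "(transpose M ** M) *v x = e *\<^sub>R x" by (simp add: eigenspace_def)
    have *: "(g i)\<^sup>2 * (v i \<bullet> x) = e * (v i \<bullet> x)" if "i < CARD('n)" for i
    proof -
      have "e * (v i \<bullet> x) = (M *v v i) \<bullet> (M *v x)"
        using x by (metis gram_inner inner_scaleR_right)
      also have "\<dots> = x \<bullet> ((transpose M ** M) *v v i)" by (simp add: gram_inner inner_commute)
      also have "\<dots> = (g i)\<^sup>2 * (v i \<bullet> x)"
        using singular_frame_eigenvector[OF fr that] by (simp add: inner_commute)
      finally show ?thesis by (rule sym)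
    qed
    have "(\<Sum>i<CARD('n). (v i \<bullet> x) *\<^sub>R v i) \<in> span (v ` ?J)"
    proof (rule span_sum)
      fix i assume "i \<in> {..<CARD('n)}"
      with * show "(v i \<bullet> x) *\<^sub>R v i \<in> span (v ` ?J)"
        by (cases "v i \<bullet> x = 0") (auto intro!: span_mul[OF span_base] simp: span_zero)
    qed
    then show "x \<in> span (v ` ?J)" using orthonormal_frame_expansion[OF v, of x] by metis
  qed
  have "subspace (eigenspace (transpose M ** M) e)"
    by (auto simp: eigenspace_def subspace_def matrix_vector_right_distrib
        matrix_vector_mult_scaleR scaleR_add_right)
  moreover have "v ` ?J \<subseteq> eigenspace (transpose M ** M) e"
    using singular_frame_eigenvector[OF fr] by (auto simp: eigenspace_def)
  ultimately show "span (v ` ?J) \<subseteq> eigenspace (transpose M ** M) e" by (rule span_minimal[rotated])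
qed

text \<open>
  The dimension of the \<open>e\<close>-eigenspace is the number of indices with \<open>(g i)\<^sup>2 = e\<close>, so the
  multiset of singular values is the multiset of the \<open>g i\<close>, grouped by their squares.
\<close>

lemma singular_values_eq_map:
  assumes fr: "singular_frame M (v :: nat \<Rightarrow> real^'n) g"
  shows "singular_values M = map g [0..<CARD('n)]"
proof -
  let ?B = "transpose M ** M" and ?J = "\<lambda>e. {i. i < CARD('n) \<and> (g i)\<^sup>2 = e}"
  let ?E = "(\<lambda>i. (g i)\<^sup>2) ` {..<CARD('n)}"
  have v: "orthonormal_frame v" using fr by (simp add: singular_frame_def)
  have g0: "g i \<ge> 0" if "i < CARD('n)" for i using fr that by (simp add: singular_frame_def)
  have dim: "dim (eigenspace ?B e) = card (?J e)" for e
    using orthonormal_frame_independent(2)[OF v, of "?J e"]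
    by (auto simp: singular_frame_eigenspace[OF fr])
  have ev: "eigenvalues ?B = ?E"
  proof -
    have "(\<exists>x\<in>eigenspace ?B e. x \<noteq> 0) \<longleftrightarrow> dim (eigenspace ?B e) \<noteq> 0" for e
      unfolding dim_eq_0 by blast
    moreover have "card (?J e) \<noteq> 0 \<longleftrightarrow> e \<in> ?E" for e by auto
    ultimately show ?thesis by (auto simp: eigenvalues_def dim)
  qed
  have "(\<Sum>e\<in>eigenvalues ?B. replicate_mset (dim (eigenspace ?B e)) (sqrt e))
      = (\<Sum>e\<in>?E. image_mset g (mset_set (?J e)))"
  proof (subst ev, rule sum.cong[OF refl])
    fix e
    have "image_mset g (mset_set (?J e)) = image_mset (\<lambda>_. sqrt e) (mset_set (?J e))"
      using g0 by (intro image_mset_cong) auto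
    also have "\<dots> = replicate_mset (card (?J e)) (sqrt e)"
      by (simp add: image_mset_const_eq)
    finally show "replicate_mset (dim (eigenspace ?B e)) (sqrt e) = image_mset g (mset_set (?J e))"
      by (simp add: dim)
  qed
  also have "\<dots> = (\<Sum>e\<in>?E. \<Sum>i\<in>?J e. {#g i#})"
    by (simp add: sum_unfold_sum_mset multiset.map_comp comp_def)
  also have "\<dots> = (\<Sum>i<CARD('n). {#g i#})"
    by (rule sum.image_gen[symmetric, where g = "\<lambda>i. (g i)\<^sup>2" and S = "{..<CARD('n)}", simplified])
  also have "\<dots> = mset (map g [0..<CARD('n)])"
    by (simp add: sum_unfold_sum_mset lessThan_atLeast0 flip: mset_upt)
  finally have ms: "singular_values M = rev (sort (map g [0..<CARD('n)]))"
    by (simp only: singular_values_def Let_def sorted_list_of_multiset_mset)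
  have "sorted (rev (map g [0..<CARD('n)]))"
    using fr by (auto simp: singular_frame_def sorted_rev_iff_nth_mono)
  then have "sort (map g [0..<CARD('n)]) = rev (map g [0..<CARD('n)])"
    by (intro properties_for_sort) simp_all
  then show ?thesis using ms by simp
qed

lemma singular_frame_exists:
  fixes M :: "real^'n^'n"
  shows "\<exists>v. singular_frame M v (\<lambda>i. singular_values M ! i)"
proof -
  let ?B = "transpose M ** M"
  have "(?B *v x) \<bullet> y = x \<bullet> (?B *v y)" for x y
    by (metis gram_inner inner_commute)
  from selfadjoint_orthonormal_eigenbasis[OF matrix_vector_mul_linear this subspace_UNIV]
  obtain E where E: "pairwise orthogonal E" "\<And>v. v \<in> E \<Longrightarrow> norm v = 1"
    "\<And>v. v \<in> E \<Longrightarrow> \<exists>e. ?B *v v = e *\<^sub>R v" "span E = UNIV"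
    by blast
  have ind: "independent E" using E(1,2) by (intro pairwise_orthogonal_independent) fastforce+
  then have fin: "finite E" by (rule independent_imp_finite)
  have card: "card E = CARD('n)" using ind E(4)
    by (metis dim_span dim_eq_card_independent dim_UNIV DIM_cart DIM_real mult.right_neutral)
  obtain ys where ys: "set ys = E" "distinct ys" using finite_distinct_list[OF fin] by blast
  define xs where "xs = sort_key (\<lambda>v. - norm (M *v v)) ys"
  have xs: "set xs = E" "distinct xs" "length xs = CARD('n)"
    using ys card distinct_card[of xs] by (auto simp: xs_def)
  have srt: "sorted (map (\<lambda>v. - norm (M *v v)) xs)" by (simp add: xs_def)
  define v where "v = (\<lambda>i. xs ! i)"
  have vE: "v i \<in> E" if "i < CARD('n)" for i using that xs by (auto simp: v_def)
  have vo: "v i \<bullet> v j = (if i = j then 1 else 0)" if ij: "i < CARD('n)" "j < CARD('n)" for i j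
  proof (cases "i = j")
    case True then show ?thesis using E(2)[OF vE[OF ij(1)]] by (simp add: dot_square_norm)
  next
    case False
    then have "v i \<noteq> v j" using xs ij by (simp add: v_def nth_eq_iff_index_eq)
    then show ?thesis using E(1) vE ij False by (auto simp: pairwise_def orthogonal_def)
  qed
  have "(M *v v i) \<bullet> (M *v v j) = (if i = j then (norm (M *v v i))\<^sup>2 else 0)"
    if ij: "i < CARD('n)" "j < CARD('n)" for i j
  proof -
    obtain e where "?B *v v j = e *\<^sub>R v j" using E(3)[OF vE[OF ij(2)]] by blast
    then have "(M *v v i) \<bullet> (M *v v j) = e * (v i \<bullet> v j)" by (metis gram_inner inner_scaleR_right)
    then show ?thesis using vo[OF ij] by (auto simp: dot_square_norm)
  qed
  moreover have "norm (M *v v j) \<le> norm (M *v v i)" if "i \<le> j" "j < CARD('n)" for i j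
    using srt that xs(3) by (auto simp: sorted_iff_nth_mono v_def)
  ultimately have fr: "singular_frame M v (\<lambda>i. norm (M *v v i))"
    using vo by (simp add: singular_frame_def orthonormal_frame_def)
  then have "singular_values M ! i = norm (M *v v i)" if "i < CARD('n)" for i
    using singular_values_eq_map[OF fr] that by simp
  then have "singular_frame M v (\<lambda>i. singular_values M ! i)"
    using fr by (auto simp: singular_frame_def)
  then show ?thesis by blast
qed

text \<open>
  In the orthonormal frame the Gram matrix of \<open>M\<close> is diagonal with entries \<open>(g i)\<^sup>2\<close>.
\<close>

lemma abs_det_singular_frame:
  assumes fr: "singular_frame (M::real^'n^'n) v g"
  shows "\<bar>det M\<bar> = (\<Prod>i<CARD('n). g i)"
proof -
  obtain f :: "'n \<Rightarrow> nat" where f: "bij_betw f UNIV {..<CARD('n)}"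
    by (metis bij_betw_iff_card finite finite_lessThan card_lessThan)
  have fl: "f i < CARD('n)" for i using f by (auto simp: bij_betw_def)
  have fi: "f i = f j \<longleftrightarrow> i = j" for i j using f by (auto simp: bij_betw_def inj_eq)
  define Q :: "real^'n^'n" where "Q = (\<chi> i j. v (f j) $ i)"
  have colQ: "column j Q = v (f j)" for j by (simp add: Q_def column_def vec_eq_iff)
  have ent: "(transpose (N ** Q) ** (N ** Q)) $ i $ j = (N *v v (f i)) \<bullet> (N *v v (f j))" for N i j
  proof -
    have "column j (N ** Q) = N *v v (f j)" for j
      by (metis colQ matrix_vector_mul_assoc matrix_vector_mult_basis)
    then show ?thesis
      by (simp add: matrix_mult_transpose_dot_column)
  qed
  have "transpose Q ** Q = mat 1"
    unfolding vec_eq_iff using ent[of "mat 1"] fr fl fi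
    by (simp add: singular_frame_def orthonormal_frame_def) (simp add: mat_def)
  then have Q1: "(det Q)\<^sup>2 = 1" by (metis det_I det_mul det_transpose power2_eq_square)
  have "det (transpose (M ** Q) ** (M ** Q)) = (\<Prod>i\<in>UNIV. (g (f i))\<^sup>2)"
    using fr fl fi by (subst det_diagonal) (simp_all add: ent singular_frame_def)
  then have "(det M)\<^sup>2 * (det Q)\<^sup>2 = (\<Prod>i\<in>UNIV. g (f i))\<^sup>2"
    by (simp add: det_mul det_transpose power2_eq_square prod.distrib ac_simps)
  also have "(\<Prod>i\<in>UNIV. g (f i)) = (\<Prod>i<CARD('n). g i)"
    by (rule prod.reindex_bij_betw[OF f])
  finally have "\<bar>det M\<bar> = \<bar>\<Prod>i<CARD('n). g i\<bar>" using Q1 by (simp add: abs_eq_iff power2_eq_iff)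
  moreover have "(\<Prod>i<CARD('n). g i) \<ge> 0"
    using fr by (intro prod_nonneg) (simp add: singular_frame_def)
  ultimately show ?thesis by simp
qed

text \<open>
  One half of the Courant-Fischer principle (indices start at 0): for dimension reasons \<open>S\<close>
  meets the span of the frame vectors from index \<open>i\<close> on, where \<open>M\<close> stretches by at most the
  \<open>i\<close>-th singular value.
\<close>

lemma singular_value_minmax_le:
  fixes M :: "real^'n^'n"
  assumes i: "i < CARD('n)" and S: "subspace S" "dim S > i"
    and r: "\<And>x. x \<in> S \<Longrightarrow> r * norm x \<le> norm (M *v x)"
  shows "r \<le> singular_values M ! i"
proof -
  let ?g = "\<lambda>i. singular_values M ! i"
  obtain v where fr: "singular_frame M v ?g" using singular_frame_exists by blast
  then have v: "orthonormal_frame v" by (simp add: singular_frame_def)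
  define T where "T = span (v ` {i..<CARD('n)})"
  have dT: "dim T = CARD('n) - i"
    unfolding T_def by (subst orthonormal_frame_independent(2)[OF v]) auto
  have "dim {x + y |x y. x \<in> S \<and> y \<in> T} + dim (S \<inter> T) = dim S + dim T"
    using S by (intro dim_sums_Int) (simp_all add: T_def)
  moreover have "dim {x + y |x y. x \<in> S \<and> y \<in> T} \<le> CARD('n)"
    using dim_subset_UNIV[of "{x + y |x y. x \<in> S \<and> y \<in> T}"] by simp
  ultimately have "dim (S \<inter> T) > 0" using S dT i by linarith
  then obtain x where x: "x \<in> S" "x \<in> T" "x \<noteq> 0"
    using dim_eq_0[of "S \<inter> T"] by (metis IntD1 IntD2 less_irrefl singletonI subsetI)
  have x0: "v j \<bullet> x = 0" if "j < i" for j
  proof -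
    have "orthogonal (v j) x" using x(2) unfolding T_def
      by (rule orthogonal_to_span) (use that i orthonormal_frameD[OF v] in \<open>auto simp: orthogonal_def\<close>)
    then show ?thesis by (simp add: orthogonal_def)
  qed
  have "(norm (M *v x))\<^sup>2 \<le> (\<Sum>j<CARD('n). (?g i)\<^sup>2 * (v j \<bullet> x)\<^sup>2)"
    unfolding singular_frame_norm[OF fr]
  proof (rule sum_mono)
    fix j assume j: "j \<in> {..<CARD('n)}"
    show "(?g j)\<^sup>2 * (v j \<bullet> x)\<^sup>2 \<le> (?g i)\<^sup>2 * (v j \<bullet> x)\<^sup>2"
    proof (cases "j < i")
      case True then show ?thesis using x0 by simp
    next
      case False
      then have "?g j \<le> ?g i" "0 \<le> ?g j" using fr j by (simp_all add: singular_frame_def)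
      then show ?thesis by (intro mult_right_mono power_mono) auto
    qed
  qed
  also have "\<dots> = (?g i * norm x)\<^sup>2"
    by (simp add: power_mult_distrib orthonormal_frame_norm[OF v] sum_distrib_left)
  finally have "norm (M *v x) \<le> ?g i * norm x"
    by (rule power2_le_imp_le) (use fr i in \<open>simp add: singular_frame_def\<close>)
  with r[OF x(1)] have "r * norm x \<le> ?g i * norm x" by linarith
  then show ?thesis using x(3) by simp
qed

text \<open>
  The other half: the span of the first \<open>i + 1\<close> frame vectors.
\<close>

lemma singular_value_minmax_attained:
  fixes M :: "real^'n^'n"
  assumes i: "i < CARD('n)"
  shows "\<exists>S. subspace S \<and> dim S = Suc i \<and> (\<forall>x\<in>S. singular_values M ! i * norm x \<le> norm (M *v x))"
proof -
  let ?g = "\<lambda>i. singular_values M ! i"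
  obtain v where fr: "singular_frame M v ?g" using singular_frame_exists by blast
  then have v: "orthonormal_frame v" by (simp add: singular_frame_def)
  define S where "S = span (v ` {..i})"
  have "dim S = Suc i"
    unfolding S_def using i by (subst orthonormal_frame_independent(2)[OF v]) auto
  moreover have "?g i * norm x \<le> norm (M *v x)" if x: "x \<in> S" for x
  proof (rule power2_le_imp_le)
    have x0: "v j \<bullet> x = 0" if "i < j" "j < CARD('n)" for j
    proof -
      have "orthogonal (v j) x" using x unfolding S_def
        by (rule orthogonal_to_span) (use that i orthonormal_frameD[OF v] in \<open>auto simp: orthogonal_def\<close>)
      then show ?thesis by (simp add: orthogonal_def)
    qed
    have "(?g i * norm x)\<^sup>2 = (\<Sum>j<CARD('n). (?g i)\<^sup>2 * (v j \<bullet> x)\<^sup>2)"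
      by (simp add: power_mult_distrib orthonormal_frame_norm[OF v] sum_distrib_left)
    also have "\<dots> \<le> (norm (M *v x))\<^sup>2"
      unfolding singular_frame_norm[OF fr]
    proof (rule sum_mono)
      fix j assume j: "j \<in> {..<CARD('n)}"
      show "(?g i)\<^sup>2 * (v j \<bullet> x)\<^sup>2 \<le> (?g j)\<^sup>2 * (v j \<bullet> x)\<^sup>2"
      proof (cases "i < j")
        case True then show ?thesis using x0 j by simp
      next
        case False
        then have "?g i \<le> ?g j" "0 \<le> ?g i" using fr j i by (simp_all add: singular_frame_def)
        then show ?thesis by (intro mult_right_mono power_mono) auto
      qed
    qed
    finally show "(?g i * norm x)\<^sup>2 \<le> (norm (M *v x))\<^sup>2" .
  qed simp
  ultimately show ?thesis unfolding S_def by (intro exI[of _ "span (v ` {..i})"]) simp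
qed

lemma singular_value_mono:
  fixes M N :: "real^'n^'n"
  assumes i: "i < CARD('n)" and le: "\<And>x. norm (M *v x) \<le> norm (N *v x)"
  shows "singular_values M ! i \<le> singular_values N ! i"
proof -
  obtain S where S: "subspace S" "dim S = Suc i"
    "\<And>x. x \<in> S \<Longrightarrow> singular_values M ! i * norm x \<le> norm (M *v x)"
    using singular_value_minmax_attained[OF i] by blast
  show ?thesis
    by (rule singular_value_minmax_le[OF i S(1)]) (use S le in \<open>auto intro: order_trans\<close>)
qed

text \<open>
  The preimage under \<open>D\<close> of a subspace on which \<open>M\<close> stretches by at least \<open>r\<close> has the same
  dimension, and \<open>M ** D\<close> stretches by at least \<open>r\<close> there.
\<close>

lemma singular_value_mult_expanding:
  fixes M D :: "real^'n^'n"
  assumes i: "i < CARD('n)" and exp: "\<And>x. norm x \<le> norm (D *v x)"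
  shows "singular_values M ! i \<le> singular_values (M ** D) ! i"
proof -
  obtain S where S: "subspace S" "dim S = Suc i"
    "\<And>x. x \<in> S \<Longrightarrow> singular_values M ! i * norm x \<le> norm (M *v x)"
    using singular_value_minmax_attained[OF i] by blast
  have inj: "inj ((*v) D)"
  proof (rule injI)
    fix x y assume "D *v x = D *v y"
    then show "x = y" using exp[of "x - y"] by (simp add: matrix_vector_mult_diff_distrib)
  qed
  then have bij: "surj ((*v) D)"
    using linear_injective_imp_surjective matrix_vector_mul_linear by blast
  define T where "T = (*v) D -` S"
  have "(*v) D ` T = S" using bij by (auto simp: T_def surj_def image_iff)
  moreover have T: "subspace T"
    unfolding T_def by (rule linear_subspace_vimage[OF matrix_vector_mul_linear S(1)])
  ultimately have dT: "dim T = Suc i"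
    using dim_image_eq[OF matrix_vector_mul_linear, of D T] inj S(2) by (metis inj_on_subset subset_UNIV)
  have s0: "0 \<le> singular_values M ! i"
    using singular_frame_exists[of M] i by (auto simp: singular_frame_def)
  show ?thesis
  proof (rule singular_value_minmax_le[OF i T])
    show "i < dim T" using dT by simp
    fix x assume "x \<in> T"
    then have "singular_values M ! i * norm (D *v x) \<le> norm ((M ** D) *v x)"
      using S(3) by (simp add: T_def flip: matrix_vector_mul_assoc)
    moreover have "singular_values M ! i * norm x \<le> singular_values M ! i * norm (D *v x)"
      by (intro mult_left_mono exp s0)
    ultimately show "singular_values M ! i * norm x \<le> norm ((M ** D) *v x)" by linarith
  qed
qed

lemma singular_value_ge:
  fixes M :: "real^'n^'n"
  assumes i: "i < CARD('n)" and r: "\<And>x. r * norm x \<le> norm (M *v x)"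
  shows "r \<le> singular_values M ! i"
  by (rule singular_value_minmax_le[OF i subspace_UNIV]) (use i r in auto)

lemma singular_value_le:
  fixes M :: "real^'n^'n"
  assumes i: "i < CARD('n)" and r: "\<And>x. norm (M *v x) \<le> r * norm x"
  shows "singular_values M ! i \<le> r"
proof -
  obtain S where S: "subspace S" "dim S = Suc i"
    "\<And>x. x \<in> S \<Longrightarrow> singular_values M ! i * norm x \<le> norm (M *v x)"
    using singular_value_minmax_attained[OF i] by blast
  then obtain x where "x \<in> S" "x \<noteq> 0"
    using dim_eq_0[of S] by (metis Zero_not_Suc singletonI subsetI)
  then have "singular_values M ! i * norm x \<le> r * norm x" using S(3) r by (meson order_trans)
  then show ?thesis using \<open>x \<noteq> 0\<close> by simp
qed

text \<open>
  The matrix \<open>D\<close> is diagonal in a singular frame of \<open>M\<close> and stretches just enough to raise all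
  singular values of \<open>M\<close> that are below \<open>a\<close> to \<open>a\<close>.
\<close>

lemma singular_value_raise:
  fixes M :: "real^'n^'n"
  assumes pos: "0 < a" "\<And>i. i < CARD('n) \<Longrightarrow> 0 < singular_values M ! i"
  shows "\<exists>D. (\<forall>x. norm x \<le> norm (D *v x)) \<and>
    (\<forall>x. norm (M *v x) \<le> norm ((M ** D) *v x)) \<and>
    (\<forall>x. a * norm x \<le> norm ((M ** D) *v x)) \<and>
    \<bar>det (M ** D)\<bar> = (\<Prod>i<CARD('n). max a (singular_values M ! i))"
proof -
  let ?g = "\<lambda>i. singular_values M ! i" and ?h = "\<lambda>i. max a (singular_values M ! i)"
  let ?d = "CARD('n)"
  obtain v where fr: "singular_frame M v ?g" using singular_frame_exists by blast
  then have v: "orthonormal_frame v" by (simp add: singular_frame_def)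
  \<comment> \<open>the diagonal map in the frame \<open>v\<close> whose factors \<open>?h i / ?g i \<ge> 1\<close> turn \<open>?g i\<close> into \<open>?h i\<close>\<close>
  define f where "f = (\<lambda>x. \<Sum>i<?d. (?h i / ?g i * (v i \<bullet> x)) *\<^sub>R v i)"
  have "linear f"
    unfolding f_def
    by (intro linear_compose_sum ballI linearI) (simp_all add: inner_add_right algebra_simps add_divide_distrib)
  define D where "D = matrix f"
  have D: "D *v x = f x" for x unfolding D_def by (simp add: matrix_works \<open>linear f\<close>)
  have Dv: "D *v v j = (?h j / ?g j) *\<^sub>R v j" if j: "j < ?d" for j
  proof -
    have "f (v j) = (\<Sum>i<?d. if i = j then (?h j / ?g j) *\<^sub>R v j else 0)"
      unfolding f_def by (intro sum.cong refl) (use j in \<open>auto simp: orthonormal_frameD[OF v]\<close>)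
    then show ?thesis using j by (simp add: D)
  qed
  have MDv: "(M ** D) *v v j = (?h j / ?g j) *\<^sub>R (M *v v j)" if "j < ?d" for j
    using Dv[OF that] by (simp add: matrix_vector_mult_scaleR flip: matrix_vector_mul_assoc)
  have fr': "singular_frame (M ** D) v ?h"
    unfolding singular_frame_def
  proof (intro conjI allI impI v)
    fix i j assume ij: "i < ?d" "j < ?d"
    show "((M ** D) *v v i) \<bullet> ((M ** D) *v v j) = (if i = j then (?h i)\<^sup>2 else 0)"
      using fr ij pos(2)[OF ij(1)]
      by (auto simp: MDv singular_frame_def power2_eq_square)
  next
    fix i show "0 \<le> ?h i" using pos by (simp add: max_def)
  next
    fix i j assume "j < ?d" "i \<le> j"
    then have "?g j \<le> ?g i" using fr by (simp add: singular_frame_def)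
    then show "?h j \<le> ?h i" by (simp add: max_def)
  qed
  have pw: "norm x \<le> norm (D *v x)" for x
  proof (rule power2_le_imp_le)
    have "(norm x)\<^sup>2 = (\<Sum>i<?d. 1 * (v i \<bullet> x)\<^sup>2)" by (simp add: orthonormal_frame_norm[OF v])
    also have "\<dots> \<le> (\<Sum>i<?d. (?h i / ?g i)\<^sup>2 * (v i \<bullet> x)\<^sup>2)"
    proof (intro sum_mono mult_right_mono one_le_power)
      fix i assume "i \<in> {..<?d}"
      then show "1 \<le> ?h i / ?g i" using pos(2)[of i] by simp
    qed simp
    also have "\<dots> = (norm (D *v x))\<^sup>2"
      unfolding D f_def
      by (subst norm_sum_orthogonal_sq[where b = "\<lambda>_. 1"])
        (simp_all add: orthonormal_frameD[OF v] power_mult_distrib power_divide)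
    finally show "(norm x)\<^sup>2 \<le> (norm (D *v x))\<^sup>2" .
  qed simp
  have "norm (M *v x) \<le> norm ((M ** D) *v x)" for x
  proof (rule power2_le_imp_le)
    show "(norm (M *v x))\<^sup>2 \<le> (norm ((M ** D) *v x))\<^sup>2"
      unfolding singular_frame_norm[OF fr] singular_frame_norm[OF fr']
      using pos(2) by (intro sum_mono mult_right_mono power_mono) (auto intro: less_imp_le)
  qed simp
  moreover have "a * norm x \<le> norm ((M ** D) *v x)" for x
  proof (rule power2_le_imp_le)
    have "(a * norm x)\<^sup>2 = (\<Sum>j<?d. a\<^sup>2 * (v j \<bullet> x)\<^sup>2)"
      by (simp add: power_mult_distrib orthonormal_frame_norm[OF v] sum_distrib_left)
    also have "\<dots> \<le> (norm ((M ** D) *v x))\<^sup>2"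
      unfolding singular_frame_norm[OF fr']
      using pos(1) by (intro sum_mono mult_right_mono power_mono) auto
    finally show "(a * norm x)\<^sup>2 \<le> (norm ((M ** D) *v x))\<^sup>2" .
  qed simp
  moreover have "\<bar>det (M ** D)\<bar> = (\<Prod>i<?d. ?h i)" by (rule abs_det_singular_frame[OF fr'])
  ultimately show ?thesis using pw by blast
qed

definition singular_product :: "nat \<Rightarrow> real^'n^'n \<Rightarrow> real" where
  "singular_product k M = (\<Prod>i<k. singular_values M ! i)"

lemma prod_split_tail:
  fixes h :: "nat \<Rightarrow> real"
  assumes "k \<le> d" shows "(\<Prod>i<d. h i) = (\<Prod>i<k. h i) * (\<Prod>i=k..<d. h i)"
  using assms by (simp add: lessThan_atLeast0 prod.atLeastLessThan_concat)

text \<open>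
  Let \<open>a\<close> and \<open>b\<close> be the \<open>k\<close>-th singular values of \<open>A\<close> and \<open>B\<close>, raise the smaller ones to \<open>a\<close> and \<open>b\<close>,
  and call the product of the modified matrices \<open>C\<close>. Each singular value of \<open>C\<close> is at least
  the corresponding one of \<open>A ** B\<close>, and also at least \<open>a b\<close>. Using the first bound for the \<open>k\<close>
  largest and the second for the others,
  \<open>\<psi>\<^sub>k(A B) (a b)\<^bsup>d-k\<^esup> \<le> \<bar>det C\<bar> = \<psi>\<^sub>k(A) a\<^bsup>d-k\<^esup> \<psi>\<^sub>k(B) b\<^bsup>d-k\<^esup>\<close>.
\<close>

theorem singular_product_mult_le:
  fixes A B :: "real^'n^'n"
  assumes k: "k \<le> CARD('n)"
    and pA: "\<And>i. i < CARD('n) \<Longrightarrow> 0 < singular_values A ! i"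
    and pB: "\<And>i. i < CARD('n) \<Longrightarrow> 0 < singular_values B ! i"
  shows "singular_product k (A ** B) \<le> singular_product k A * singular_product k B"
proof (cases "k = 0")
  case True then show ?thesis by (simp add: singular_product_def)
next
  case False
  let ?d = "CARD('n)" and ?g = "\<lambda>M i. singular_values M ! i"
  define a b where "a = ?g A (k - 1)" and "b = ?g B (k - 1)"
  have k1: "k - 1 < ?d" using k False by simp
  have ab: "0 < a" "0 < b" using pA pB k1 by (simp_all add: a_def b_def)
  obtain D1 where D1: "\<And>x. norm (A *v x) \<le> norm ((A ** D1) *v x)"
    "\<And>x. a * norm x \<le> norm ((A ** D1) *v x)" "\<bar>det (A ** D1)\<bar> = (\<Prod>i<?d. max a (?g A i))"
    using singular_value_raise[OF ab(1) pA] by blast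
  obtain D2 where D2: "\<And>x. norm x \<le> norm (D2 *v x)"
    "\<And>x. b * norm x \<le> norm ((B ** D2) *v x)" "\<bar>det (B ** D2)\<bar> = (\<Prod>i<?d. max b (?g B i))"
    using singular_value_raise[OF ab(2) pB] by blast
  define C where "C = (A ** D1) ** (B ** D2)"
  have decr: "?g M j \<le> ?g M i" if "i \<le> j" "j < ?d" for M :: "real^'n^'n" and i j
    using singular_frame_exists[of M] that by (auto simp: singular_frame_def)
  have nn: "0 \<le> ?g M j" if "j < ?d" for M :: "real^'n^'n" and j
    using singular_frame_exists[of M] that by (auto simp: singular_frame_def)
  have head: "?g (A ** B) i \<le> ?g C i" if i: "i < ?d" for i
  proof -
    have "?g (A ** B) i \<le> ?g ((A ** D1) ** B) i"
      by (rule singular_value_mono[OF i]) (use D1(1) in \<open>simp flip: matrix_vector_mul_assoc\<close>)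
    also have "\<dots> \<le> ?g (((A ** D1) ** B) ** D2) i"
      by (rule singular_value_mult_expanding[OF i D2(1)])
    finally show ?thesis by (simp add: C_def matrix_mul_assoc)
  qed
  have tail: "a * b \<le> ?g C i" if i: "i < ?d" for i
  proof (rule singular_value_ge[OF i])
    fix x
    have "a * b * norm x \<le> a * norm ((B ** D2) *v x)"
      using D2(2)[of x] ab by (simp add: mult.assoc)
    also have "\<dots> \<le> norm ((A ** D1) *v ((B ** D2) *v x))" by (rule D1(2))
    finally show "a * b * norm x \<le> norm (C *v x)" by (simp add: C_def matrix_vector_mul_assoc)
  qed
  have raised: "(\<Prod>i<?d. max (?g M (k-1)) (?g M i)) = singular_product k M * (?g M (k-1)) ^ (?d - k)"
    for M :: "real^'n^'n"
  proof -
    have "(\<Prod>i<k. max (?g M (k-1)) (?g M i)) = singular_product k M"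
      unfolding singular_product_def
      by (intro prod.cong refl max_absorb2 decr) (use k in auto)
    moreover have "(\<Prod>i=k..<?d. max (?g M (k-1)) (?g M i)) = (\<Prod>i=k..<?d. ?g M (k-1))"
      by (intro prod.cong refl max_absorb1 decr) auto
    ultimately show ?thesis using prod_split_tail[OF k] by simp
  qed
  obtain v where fr: "singular_frame C v (?g C)" using singular_frame_exists by blast
  have "singular_product k (A ** B) * (a * b) ^ (?d - k) \<le> (\<Prod>i<k. ?g C i) * (\<Prod>i=k..<?d. ?g C i)"
  proof (rule mult_mono)
    show "singular_product k (A ** B) \<le> (\<Prod>i<k. ?g C i)"
      unfolding singular_product_def by (intro prod_mono conjI nn head) (use k in auto)
    have "(a * b) ^ (?d - k) = (\<Prod>i=k..<?d. a * b)" by simp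
    also have "\<dots> \<le> (\<Prod>i=k..<?d. ?g C i)"
      by (intro prod_mono conjI tail) (use ab in auto)
    finally show "(a * b) ^ (?d - k) \<le> (\<Prod>i=k..<?d. ?g C i)" .
  qed (use ab k in \<open>auto intro!: prod_nonneg nn\<close>)
  also have "\<dots> = \<bar>det C\<bar>"
    using prod_split_tail[OF k] abs_det_singular_frame[OF fr] by simp
  also have "\<dots> = singular_product k A * singular_product k B * (a * b) ^ (?d - k)"
    using raised[of A] raised[of B] D1(3) D2(3)
    by (simp add: C_def det_mul abs_mult a_def b_def power_mult_distrib)
  finally show ?thesis using ab by simp
qed

section \<open>Subadditive sequences\<close>

lemma subadditive_mult_add:
  fixes a :: "nat \<Rightarrow> real"
  assumes sub: "\<And>m n. a (m + n) \<le> a m + a n"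
  shows "a (q * m + r) \<le> real q * a m + a r"
proof (induction q)
  case (Suc q)
  have "a (Suc q * m + r) \<le> a m + a (q * m + r)" using sub[of m "q * m + r"] by (simp add: add.assoc)
  with Suc show ?case by (simp add: algebra_simps)
qed simp

text \<open>
  Fekete's lemma. The second conclusion, that the limit is a lower bound at every finite
  stage, is as important below as the convergence.
\<close>

lemma fekete_subadditive:
  fixes a :: "nat \<Rightarrow> real"
  assumes sub: "\<And>m n. a (m + n) \<le> a m + a n" and lower: "\<And>n. - C * real n \<le> a n"
  obtains L where "(\<lambda>n. a n / real n) \<longlonglongrightarrow> L" "\<And>n. n \<ge> 1 \<Longrightarrow> L \<le> a n / real n"
proof -
  let ?X = "(\<lambda>n. a n / real n) ` {1..}"
  define L where "L = Inf ?X"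
  have bdd: "bdd_below ?X"
    by (rule bdd_belowI2[where m = "- C"]) (use lower in \<open>simp add: field_simps\<close>)
  have L: "L \<le> a n / real n" if "n \<ge> 1" for n
    unfolding L_def using bdd that by (intro cInf_lower) auto
  have "(\<lambda>n. a n / real n) \<longlonglongrightarrow> L"
  proof (rule LIMSEQ_I)
    fix e :: real assume e: "e > 0"
    have "Inf ?X < L + e / 2" using e by (simp add: L_def)
    then obtain m where m: "m \<ge> 1" "a m / real m < L + e / 2"
      using cInf_lessD[of ?X] by auto
    define b where "b = a m / real m"
    have am: "a m = real m * b" using m by (simp add: b_def)
    \<comment> \<open>the error of writing \<open>n\<close> as a multiple of \<open>m\<close> plus a remainder, uniform in \<open>n\<close>\<close>
    define B where "B = real m * \<bar>b\<bar> + (\<Sum>r<m. \<bar>a r\<bar>)"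
    have B: "a n / real n \<le> a m / real m + B / real n" if n: "n \<ge> 1" for n
    proof -
      let ?q = "n div m" and ?r = "n mod m"
      have r: "?r < m" using m by simp
      have "a n \<le> real ?q * a m + a ?r" using subadditive_mult_add[of a ?q m ?r] sub by simp
      also have "real ?q * a m = (real n - real ?r) * b"
      proof -
        have "real ?q * real m = real n - real ?r"
          by (metis add_diff_cancel_right' div_mult_mod_eq of_nat_add of_nat_mult)
        then show ?thesis by (simp add: am flip: mult.assoc)
      qed
      also have "\<dots> \<le> real n * b + real m * \<bar>b\<bar>"
      proof -
        have "real ?r * - b \<le> real ?r * \<bar>b\<bar>" by (intro mult_left_mono) auto
        also have "\<dots> \<le> real m * \<bar>b\<bar>" using r by (intro mult_right_mono) auto
        finally show ?thesis by (simp add: left_diff_distrib)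
      qed
      also have "a ?r \<le> (\<Sum>r<m. \<bar>a r\<bar>)"
        using member_le_sum[of ?r "{..<m}" "\<lambda>r. \<bar>a r\<bar>"] r by auto
      finally have "a n \<le> real n * b + B" by (simp add: B_def)
      then show ?thesis using n unfolding b_def[symmetric] by (simp add: field_simps)
    qed
    obtain N where N: "real N > 2 * B / e" using reals_Archimedean2 by blast
    show "\<exists>N. \<forall>n\<ge>N. norm (a n / real n - L) < e"
    proof (intro exI allI impI)
      fix n assume n: "n \<ge> max 1 N"
      have "2 * B / e < real n" using N n by linarith
      then have "B / real n < e / 2" using e n by (simp add: field_simps)
      moreover have "a n / real n \<le> a m / real m + B / real n" "L \<le> a n / real n"
        using B[of n] L[of n] n by simp_all
      ultimately have "a n / real n - L < e" "0 \<le> a n / real n - L" using m(2) by linarith+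
      then show "norm (a n / real n - L) < e" by simp
    qed
  qed
  with L that show ?thesis by blast
qed

section \<open>The mean ergodic theorem for subadditive processes\<close>

text \<open>
  Invariance is expressed through the image measure, so that integrals can be transported
  along \<open>T\<close>.
\<close>

locale measure_preserving_system = prob_space +
  fixes T :: "'a \<Rightarrow> 'a"
  assumes T_measurable [measurable]: "T \<in> M \<rightarrow>\<^sub>M M"
    and T_preserves: "distr M M T = M"
begin

definition birkhoff_sum :: "('a \<Rightarrow> real) \<Rightarrow> nat \<Rightarrow> 'a \<Rightarrow> real" where
  "birkhoff_sum g n x = (\<Sum>k<n. g ((T ^^ k) x))"

lemma birkhoff_sum_0 [simp]: "birkhoff_sum g 0 x = 0"
  by (simp add: birkhoff_sum_def)

lemma birkhoff_sum_Suc: "birkhoff_sum g (Suc n) x = g x + birkhoff_sum g n (T x)"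
  unfolding birkhoff_sum_def sum.lessThan_Suc_shift by (simp add: funpow_swap1)

lemma funpow_measurable [measurable]: "(T ^^ k) \<in> M \<rightarrow>\<^sub>M M"
  by (induction k) (auto simp: measurable_ident intro: measurable_comp)

lemma birkhoff_sum_measurable [measurable]:
  "g \<in> borel_measurable M \<Longrightarrow> birkhoff_sum g n \<in> borel_measurable M"
  unfolding birkhoff_sum_def by (intro borel_measurable_sum measurable_compose[OF funpow_measurable])

lemma integral_comp_T:
  fixes f :: "'a \<Rightarrow> real"
  assumes "f \<in> borel_measurable M"
  shows "integral\<^sup>L M (\<lambda>x. f (T x)) = integral\<^sup>L M f"
  using integral_distr[OF T_measurable assms] by (simp add: T_preserves)

text \<open>
  The recursion computes \<open>max {0, S\<^sub>1 g, \<dots>, S\<^sub>n g}\<close>, the running maximum of the Birkhoff sums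
  of \<open>g\<close>.
\<close>

primrec max_birkhoff :: "('a \<Rightarrow> real) \<Rightarrow> nat \<Rightarrow> 'a \<Rightarrow> real" where
  "max_birkhoff g 0 x = 0"
| "max_birkhoff g (Suc n) x = max 0 (g x + max_birkhoff g n (T x))"

lemma max_birkhoff_nonneg: "0 \<le> max_birkhoff g n x"
  by (cases n) auto

lemma max_birkhoff_mono: "max_birkhoff g n x \<le> max_birkhoff g (Suc n) x"
proof (induction n arbitrary: x)
  case (Suc n)
  have "g x + max_birkhoff g n (T x) \<le> g x + max_birkhoff g (Suc n) (T x)"
    using Suc.IH[of "T x"] by (rule add_left_mono)
  then show ?case by (subst (1 2) max_birkhoff.simps(2)) (rule max.mono[OF order_refl])
qed simp

lemma max_birkhoff_mono': "m \<le> n \<Longrightarrow> max_birkhoff g m x \<le> max_birkhoff g n x"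
  by (rule lift_Suc_mono_le[of "\<lambda>n. max_birkhoff g n x"]) (auto simp: max_birkhoff_mono simp del: max_birkhoff.simps)

lemma birkhoff_sum_le_max: "birkhoff_sum g n x \<le> max_birkhoff g n x"
proof (induction n arbitrary: x)
  case (Suc n)
  then show ?case using Suc.IH[of "T x"] by (simp add: birkhoff_sum_Suc le_max_iff_disj)
qed simp

lemma max_birkhoff_measurable [measurable]:
  "g \<in> borel_measurable M \<Longrightarrow> max_birkhoff g n \<in> borel_measurable M"
proof (induction n)
  case 0
  then show ?case by (simp add: max_birkhoff.simps(1)[abs_def])
next
  case (Suc n)
  note [measurable] = Suc.IH[OF Suc.prems] Suc.prems
  show ?case unfolding max_birkhoff.simps(2)[abs_def] by measurable
qed

lemma max_birkhoff_bound:
  assumes "\<And>x. \<bar>g x\<bar> \<le> C" shows "max_birkhoff g n x \<le> real n * C"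
proof (induction n arbitrary: x)
  case (Suc n)
  have "0 \<le> C" using assms[of x] by linarith
  then show ?case using Suc.IH[of "T x"] assms[of x] by (auto simp: algebra_simps abs_le_iff)
qed simp

text \<open>
  Garsia's argument: where the running maximum \<open>M\<^bsub>n+1\<^esub>\<close> is positive it equals \<open>g + M\<^sub>n \<circ> T\<close>, so
  \<open>M\<^sub>n - M\<^sub>n \<circ> T\<close>, which has integral 0, is at most \<open>g\<close> there and at most 0 elsewhere. The sets
  where \<open>M\<^sub>n\<close> is positive exhaust the space.
\<close>

lemma maximal_ergodic:
  assumes g [measurable]: "g \<in> borel_measurable M" and C: "\<And>x. \<bar>g x\<bar> \<le> C"
    and pos: "AE x in M. \<exists>n. 0 < birkhoff_sum g n x"
  shows "0 \<le> integral\<^sup>L M g"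
proof -
  define E where "E n = {x\<in>space M. 0 < max_birkhoff g n x}" for n
  have E [measurable]: "E n \<in> sets M" for n unfolding E_def by measurable
  have C0: "0 \<le> C" using C[of undefined] by linarith
  have int: "integrable M (\<lambda>x. max_birkhoff g n x)" for n
    by (rule integrable_const_bound[where B = "real n * C"])
      (auto simp: max_birkhoff_nonneg max_birkhoff_bound[OF C])
  have intT: "integrable M (\<lambda>x. max_birkhoff g n (T x))" for n
    by (rule integrable_const_bound[where B = "real n * C"])
      (auto simp: max_birkhoff_nonneg max_birkhoff_bound[OF C])
  have intg: "integrable M (\<lambda>x. indicator (E n) x * g x)" for n
    by (rule integrable_const_bound[where B = C]) (use C C0 in \<open>auto simp: indicator_def\<close>)
  have step: "0 \<le> (\<integral>x. indicator (E (Suc n)) x * g x \<partial>M)" for n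
  proof -
    have "0 = (\<integral>x. max_birkhoff g n x \<partial>M) - (\<integral>x. max_birkhoff g n (T x) \<partial>M)"
      by (subst integral_comp_T) auto
    also have "\<dots> = (\<integral>x. max_birkhoff g n x - max_birkhoff g n (T x) \<partial>M)"
      by (simp add: int intT)
    also have "\<dots> \<le> (\<integral>x. indicator (E (Suc n)) x * g x \<partial>M)"
    proof (rule integral_mono)
      fix x assume x: "x \<in> space M"
      have "max_birkhoff g n x \<le> max_birkhoff g (Suc n) x" by (rule max_birkhoff_mono)
      then show "max_birkhoff g n x - max_birkhoff g n (T x) \<le> indicator (E (Suc n)) x * g x"
        using x max_birkhoff_nonneg[of g n "T x"] by (auto simp: E_def indicator_def max_def split: if_splits)
    qed (use int intT intg in auto)
    finally show ?thesis .
  qed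
  have "(\<lambda>n. \<integral>x. indicator (E (Suc n)) x * g x \<partial>M) \<longlonglongrightarrow> (\<integral>x. g x \<partial>M)"
  proof (rule integral_dominated_convergence[where w = "\<lambda>_. C"])
    show "AE x in M. (\<lambda>n. indicator (E (Suc n)) x * g x) \<longlonglongrightarrow> g x"
      using pos AE_space
    proof eventually_elim
      case (elim x)
      from elim obtain N where "0 < birkhoff_sum g N x" by blast
      then have "0 < max_birkhoff g N x" using birkhoff_sum_le_max[of g N x] by linarith
      then have "x \<in> E (Suc n)" if "n \<ge> N" for n
        using max_birkhoff_mono'[of N "Suc n" g x] that elim unfolding E_def
        by (auto simp del: max_birkhoff.simps)
      then have "\<forall>\<^sub>F n in sequentially. indicator (E (Suc n)) x * g x = g x"
        by (auto simp: eventually_sequentially intro!: exI[of _ N])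
      then show ?case by (rule tendsto_eventually)
    qed
    show "AE x in M. norm (indicator (E (Suc n)) x * g x) \<le> C" for n
      using C C0 by (auto simp: indicator_def)
  qed auto
  then show ?thesis by (rule LIMSEQ_le_const) (use step in auto)
qed

end

locale ergodic_system = measure_preserving_system +
  assumes ergodic: "\<And>B. B \<in> sets M \<Longrightarrow> T -` B \<inter> space M = B \<Longrightarrow> prob B = 0 \<or> prob B = 1"
begin

text \<open>
  The set where the Birkhoff sums of \<open>g = f - (\<integral>f + e)\<close> are unbounded above is exactly
  invariant. If it had full measure, the maximal ergodic theorem would give \<open>\<integral>g \<ge> 0\<close>,
  whereas \<open>\<integral>g = - e\<close>.
\<close>

lemma birkhoff_upper:
  assumes f [measurable]: "f \<in> borel_measurable M" and C: "\<And>x. \<bar>f x\<bar> \<le> C" and e: "e > 0"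
  shows "AE x in M. \<exists>b. \<forall>n. birkhoff_sum f n x \<le> real n * (integral\<^sup>L M f + e) + b"
proof -
  define g where "g = (\<lambda>x. f x - (integral\<^sup>L M f + e))"
  have g [measurable]: "g \<in> borel_measurable M" by (simp add: g_def)
  have intf: "integrable M f" by (rule integrable_const_bound[where B = C]) (use C in auto)
  have ig: "integral\<^sup>L M g = - e" by (simp add: g_def intf prob_space)
  have Sg: "birkhoff_sum g n x = birkhoff_sum f n x - real n * (integral\<^sup>L M f + e)" for n x
    by (simp add: birkhoff_sum_def g_def sum_subtractf)
  define B where "B = {x\<in>space M. \<forall>k::nat. \<exists>n. real k < birkhoff_sum g n x}"
  have B: "B \<in> sets M" unfolding B_def by measurable
  have "T -` B \<inter> space M = B"
  proof (intro set_eqI iffI)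
    fix x assume "x \<in> T -` B \<inter> space M"
    then have x: "x \<in> space M" "\<And>k::nat. \<exists>n. real k < birkhoff_sum g n (T x)" by (auto simp: B_def)
    have "\<exists>n. real k < birkhoff_sum g n x" for k :: nat
    proof -
      obtain n where "real (k + nat \<lceil>\<bar>g x\<bar>\<rceil>) < birkhoff_sum g n (T x)" using x(2) by blast
      then have "real k < birkhoff_sum g (Suc n) x"
        using real_nat_ceiling_ge[of "\<bar>g x\<bar>"] unfolding birkhoff_sum_Suc of_nat_add by linarith
      then show ?thesis by blast
    qed
    then show "x \<in> B" using x(1) by (simp add: B_def)
  next
    fix x assume "x \<in> B"
    then have x: "x \<in> space M" "\<And>k::nat. \<exists>n. real k < birkhoff_sum g n x" by (auto simp: B_def)
    have "\<exists>n. real k < birkhoff_sum g n (T x)" for k :: nat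
    proof -
      obtain n where n: "real (k + nat \<lceil>\<bar>g x\<bar>\<rceil>) < birkhoff_sum g n x" using x(2) by blast
      have "n \<noteq> 0"
      proof
        assume "n = 0"
        with n have "real (k + nat \<lceil>\<bar>g x\<bar>\<rceil>) < 0" by simp
        then show False by linarith
      qed
      then obtain n' where "n = Suc n'" by (cases n) auto
      then have "real k < birkhoff_sum g n' (T x)"
        using n real_nat_ceiling_ge[of "\<bar>g x\<bar>"]
        unfolding \<open>n = Suc n'\<close> birkhoff_sum_Suc of_nat_add by linarith
      then show ?thesis by blast
    qed
    moreover have "T x \<in> space M" using x(1) measurable_space[OF T_measurable] by blast
    ultimately show "x \<in> T -` B \<inter> space M" using x(1) by (simp add: B_def)
  qed
  from ergodic[OF B this] have "prob B = 0"
  proof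
    assume "prob B = 1"
    then have "AE x in M. x \<in> B" by (simp add: prob_eq_1 B)
    then have "AE x in M. \<exists>n. 0 < birkhoff_sum g n x"
    proof eventually_elim
      case (elim x)
      then have "\<exists>n. real 0 < birkhoff_sum g n x" unfolding B_def by blast
      then show ?case by simp
    qed
    then have "0 \<le> integral\<^sup>L M g"
    proof (rule maximal_ergodic[rotated 2])
      fix x show "\<bar>g x\<bar> \<le> C + \<bar>integral\<^sup>L M f + e\<bar>" using C[of x] unfolding g_def by linarith
    qed simp
    then show ?thesis using ig e by simp
  qed
  then have "AE x in M. x \<notin> B" by (simp add: prob_eq_0 B)
  moreover have "AE x in M. x \<in> space M" by simp
  ultimately show ?thesis
  proof eventually_elim
    case (elim x)
    then obtain k :: nat where "\<And>n. birkhoff_sum g n x \<le> real k" unfolding B_def by (auto simp: not_less)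
    then show ?case by (intro exI[of _ "real k"]) (simp add: Sg algebra_simps)
  qed
qed

end

locale subadditive_process = ergodic_system +
  fixes f :: "nat \<Rightarrow> 'a \<Rightarrow> real" and C :: real
  assumes f_measurable [measurable]: "\<And>n. f n \<in> borel_measurable M"
    and f_bound: "\<And>n x. \<bar>f n x\<bar> \<le> C * real n"
    and f_subadditive: "\<And>m n x. f (m + n) x \<le> f m x + f n ((T ^^ m) x)"
begin

lemma C_nonneg: "0 \<le> C"
  using f_bound[of 1 undefined] by simp

lemma f_integrable: "integrable M (f n)"
  by (rule integrable_const_bound[where B = "C * real n"]) (use f_bound in auto)

text \<open>
  Cutting off a first block of length \<open>j < m\<close> and averaging over \<open>j\<close> replaces \<open>f n\<close> by a sum of
  \<open>f m\<close> along the orbit. The sums \<open>H\<close> telescope along the orbit: passing from \<open>H (N - 1) (T x)\<close>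
  to \<open>H N x\<close> changes a single term, and this change is at most \<open>f m x\<close>.
\<close>

lemma subadditive_le_birkhoff_sum:
  assumes n: "n = k + m"
  shows "real m * f n x \<le> birkhoff_sum (f m) k x + 2 * C * (real m)\<^sup>2"
proof -
  define H where "H n x = (\<Sum>j<m. f (n - j) ((T ^^ j) x))" for n x
  have step: "H (Suc k + m) x \<le> f m x + H (k + m) (T x)" for k x
  proof -
    let ?N = "Suc k + m"
    let ?u = "\<lambda>j. f (?N - j) ((T ^^ j) x)"
    have "H ?N x + ?u m = ?u 0 + H (k + m) (T x)"
    proof -
      have "H ?N x + ?u m = (\<Sum>j<Suc m. ?u j)" by (simp add: H_def)
      also have "\<dots> = ?u 0 + (\<Sum>j<m. ?u (Suc j))" by (rule sum.lessThan_Suc_shift)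
      also have "(\<Sum>j<m. ?u (Suc j)) = H (k + m) (T x)"
        unfolding H_def by (intro sum.cong refl) (simp add: funpow_swap1)
      finally show ?thesis .
    qed
    moreover have "?u 0 \<le> f m x + ?u m" using f_subadditive[of m "Suc k" x] by (simp add: add.commute)
    ultimately show ?thesis by linarith
  qed
  have Hm: "H m y \<le> C * (real m)\<^sup>2" for y
  proof -
    have "H m y \<le> (\<Sum>j<m. C * real m)"
      unfolding H_def
    proof (rule sum_mono)
      fix j
      have "f (m - j) ((T ^^ j) y) \<le> C * real (m - j)" using f_bound by (auto simp: abs_le_iff)
      also have "\<dots> \<le> C * real m" using C_nonneg by (intro mult_left_mono) auto
      finally show "f (m - j) ((T ^^ j) y) \<le> C * real m" .
    qed
    then show ?thesis by (simp add: power2_eq_square algebra_simps)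
  qed
  have H: "H (k + m) x \<le> birkhoff_sum (f m) k x + C * (real m)\<^sup>2" for k x
  proof (induction k arbitrary: x)
    case 0 then show ?case using Hm by simp
  next
    case (Suc k)
    show ?case using step[of k x] Suc.IH[of "T x"] unfolding birkhoff_sum_Suc by linarith
  qed
  have "real m * f n x = (\<Sum>j<m. f n x)" by simp
  also have "\<dots> \<le> (\<Sum>j<m. C * real m + f (n - j) ((T ^^ j) x))"
  proof (rule sum_mono)
    fix j assume "j \<in> {..<m}"
    then have "f n x \<le> f j x + f (n - j) ((T ^^ j) x)"
      using f_subadditive[of j "n - j" x] n by simp
    moreover have "f j x \<le> C * real j" using f_bound[of j x] by (simp add: abs_le_iff)
    moreover have "C * real j \<le> C * real m" using C_nonneg \<open>j \<in> _\<close> by (intro mult_left_mono) auto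
    ultimately show "f n x \<le> C * real m + f (n - j) ((T ^^ j) x)" by linarith
  qed
  also have "\<dots> = C * (real m)\<^sup>2 + H n x"
    by (simp add: sum.distrib H_def power2_eq_square)
  finally show ?thesis using H[of k x] unfolding n by linarith
qed

lemma AE_subadditive_upper:
  assumes m: "m \<ge> 1" and e: "e > 0"
  shows "AE x in M. \<exists>D. \<forall>n\<ge>m. f n x / real n \<le> integral\<^sup>L M (f m) / real m + e + D / real n"
proof -
  let ?I = "integral\<^sup>L M (f m)"
  have "AE x in M. \<exists>b. \<forall>n. birkhoff_sum (f m) n x \<le> real n * (?I + e) + b"
    by (rule birkhoff_upper[OF f_measurable f_bound e])
  then show ?thesis
  proof eventually_elim
    case (elim x)
    then obtain b where b: "\<And>n. birkhoff_sum (f m) n x \<le> real n * (?I + e) + b" by blast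
    define D where "D = real m * \<bar>?I + e\<bar> + \<bar>b\<bar> + 2 * C * (real m)\<^sup>2"
    have D0: "0 \<le> D" using C_nonneg by (simp add: D_def)
    have "f n x / real n \<le> ?I / real m + e + D / real n" if n: "n \<ge> m" for n
    proof -
      have "real m * f n x \<le> birkhoff_sum (f m) (n - m) x + 2 * C * (real m)\<^sup>2"
        by (rule subadditive_le_birkhoff_sum) (use n in simp)
      also have "\<dots> \<le> real (n - m) * (?I + e) + \<bar>b\<bar> + 2 * C * (real m)\<^sup>2"
        using b[of "n - m"] by linarith
      also have "real (n - m) * (?I + e) = real n * (?I + e) - real m * (?I + e)"
        using n by (simp add: of_nat_diff left_diff_distrib)
      also have "\<dots> \<le> real n * (?I + e) + real m * \<bar>?I + e\<bar>"
        using mult_left_mono[OF abs_ge_minus_self[of "?I + e"], of "real m"]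
        by (simp add: algebra_simps)
      finally have "real m * f n x \<le> real n * (?I + e) + D" by (simp add: D_def)
      then have "f n x / real n \<le> (?I + e) / real m + D / (real n * real m)"
        using m n by (simp add: field_simps)
      also have "\<dots> \<le> ?I / real m + e + D / real n"
      proof -
        have "e / real m \<le> e" using e m by (simp add: field_simps)
        moreover have "D / (real n * real m) \<le> D / real n"
          using D0 m n by (intro divide_left_mono) auto
        ultimately show ?thesis by (simp add: add_divide_distrib)
      qed
      finally show ?thesis .
    qed
    then show ?case by blast
  qed
qed

text \<open>
  The positive part of \<open>f n / n - L\<close> tends to 0 almost everywhere and boundedly, hence in
  mean. Since the integral of \<open>f n / n - L\<close> also tends to 0, so does that of the negative
  part.
\<close>

theorem subadditive_mean_convergence:
  obtains L where "(\<lambda>n. integral\<^sup>L M (f n) / real n) \<longlonglongrightarrow> L"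
    and "(\<lambda>n. \<integral>x. \<bar>f n x / real n - L\<bar> \<partial>M) \<longlonglongrightarrow> 0"
proof -
  let ?a = "\<lambda>n. integral\<^sup>L M (f n)"
  have inv: "integral\<^sup>L M (\<lambda>x. f n ((T ^^ m) x)) = ?a n" for m n
  proof (induction m)
    case (Suc m)
    then show ?case
      using integral_comp_T[of "\<lambda>x. f n ((T ^^ m) x)"] by (simp add: funpow_swap1)
  qed simp
  have intc: "integrable M (\<lambda>x. f n ((T ^^ m) x))" for m n
    by (rule integrable_const_bound[where B = "C * real n"]) (use f_bound in auto)
  have sub: "?a (m + n) \<le> ?a m + ?a n" for m n
  proof -
    have "?a (m + n) \<le> (\<integral>x. f m x + f n ((T ^^ m) x) \<partial>M)"
      by (intro integral_mono Bochner_Integration.integrable_add f_integrable intc f_subadditive)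
    also have "\<dots> = ?a m + ?a n" by (simp add: f_integrable intc inv)
    finally show ?thesis .
  qed
  have low: "- C * real n \<le> ?a n" for n
  proof -
    have "(\<integral>x. - C * real n \<partial>M) \<le> ?a n"
      by (intro integral_mono f_integrable) (use f_bound in \<open>auto simp: abs_le_iff minus_le_iff\<close>)
    then show ?thesis by (simp add: prob_space)
  qed
  obtain L where lim: "(\<lambda>n. ?a n / real n) \<longlonglongrightarrow> L"
    using fekete_subadditive[OF sub low] by blast
  define g where "g n x = f n x / real n - L" for n x
  have gm [measurable]: "g n \<in> borel_measurable M" for n unfolding g_def by measurable
  have fb: "\<bar>f n x / real n\<bar> \<le> C" for n x
    using f_bound[of n x] C_nonneg by (cases "n = 0") (auto simp: field_simps)
  have gb: "\<bar>g n x\<bar> \<le> C + \<bar>L\<bar>" for n x using fb[of n x] unfolding g_def by linarith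
  have "AE x in M. \<forall>k. \<forall>\<^sub>F n in sequentially. g n x < 3 / real (Suc k)"
  proof (subst AE_all_countable, rule allI)
    fix k
    let ?e = "1 / real (Suc k)"
    have "\<forall>\<^sub>F n in sequentially. ?a n / real n < L + ?e"
      by (rule order_tendstoD(2)[OF lim]) simp
    then have "\<forall>\<^sub>F n in sequentially. ?a n / real n < L + ?e \<and> n \<ge> 1"
      using eventually_ge_at_top[of 1] by (rule eventually_conj)
    then obtain m where m: "m \<ge> 1" "?a m / real m < L + ?e"
      unfolding eventually_sequentially by blast
    have "AE x in M. \<exists>D. \<forall>n\<ge>m. f n x / real n \<le> ?a m / real m + ?e + D / real n"
      by (rule AE_subadditive_upper[OF m(1)]) simp
    then show "AE x in M. \<forall>\<^sub>F n in sequentially. g n x < 3 / real (Suc k)"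
    proof eventually_elim
      case (elim x)
      then obtain D where D: "\<And>n. n \<ge> m \<Longrightarrow> f n x / real n \<le> ?a m / real m + ?e + D / real n"
        by blast
      have "(\<lambda>n. D / real n) \<longlonglongrightarrow> 0" by (rule lim_const_over_n)
      then have "\<forall>\<^sub>F n in sequentially. D / real n < ?e" by (rule order_tendstoD(2)) simp
      then show ?case using eventually_ge_at_top[of m]
      proof eventually_elim
        case (elim n)
        have "g n x < ?e + ?e + ?e" using D[OF elim(2)] elim(1) m(2) unfolding g_def by linarith
        then show ?case by simp
      qed
    qed
  qed
  then have AE0: "AE x in M. (\<lambda>n. max 0 (g n x)) \<longlonglongrightarrow> 0"
  proof eventually_elim
    case (elim x)
    show ?case
    proof (rule order_tendstoI)
      fix a :: real assume "a < 0"
      then show "\<forall>\<^sub>F n in sequentially. a < max 0 (g n x)" by (intro always_eventually) auto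
    next
      fix a :: real assume a: "0 < a"
      obtain k where "real k > 3 / a" using reals_Archimedean2 by blast
      then have "3 / real (Suc k) < a" using a by (simp add: field_simps)
      with elim[rule_format, of k] show "\<forall>\<^sub>F n in sequentially. max 0 (g n x) < a"
        using a by (auto elim: eventually_mono)
    qed
  qed
  have "(\<lambda>n. \<integral>x. max 0 (g n x) \<partial>M) \<longlonglongrightarrow> (\<integral>x. 0 \<partial>M)"
  proof (rule integral_dominated_convergence[where w = "\<lambda>_. C + \<bar>L\<bar>", OF _ _ _ AE0])
    show "AE x in M. norm (max 0 (g n x)) \<le> C + \<bar>L\<bar>" for n
      using gb[of n] C_nonneg by (intro always_eventually) (auto simp: max_def abs_le_iff)
  qed auto
  then have pos: "(\<lambda>n. \<integral>x. max 0 (g n x) \<partial>M) \<longlonglongrightarrow> 0" by simp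
  have int: "integrable M (g n)" for n
    by (rule integrable_const_bound[where B = "C + \<bar>L\<bar>"]) (use gb in auto)
  have intmax: "integrable M (\<lambda>x. max 0 (g n x))" for n
    by (intro Bochner_Integration.integrable_max int) simp
  have "(\<integral>x. \<bar>g n x\<bar> \<partial>M) = 2 * (\<integral>x. max 0 (g n x) \<partial>M) - (?a n / real n - L)" for n
  proof -
    have "(\<integral>x. \<bar>g n x\<bar> \<partial>M) = (\<integral>x. 2 * max 0 (g n x) - g n x \<partial>M)"
      by (intro Bochner_Integration.integral_cong refl) (auto simp: max_def)
    also have "\<dots> = 2 * (\<integral>x. max 0 (g n x) \<partial>M) - (\<integral>x. g n x \<partial>M)"
      by (simp add: int intmax)
    also have "(\<integral>x. g n x \<partial>M) = ?a n / real n - L"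
      unfolding g_def by (simp add: f_integrable prob_space)
    finally show ?thesis .
  qed
  moreover have "(\<lambda>n. 2 * (\<integral>x. max 0 (g n x) \<partial>M) - (?a n / real n - L)) \<longlonglongrightarrow> 2 * 0 - (L - L)"
    by (intro tendsto_intros pos lim)
  ultimately have "(\<lambda>n. \<integral>x. \<bar>g n x\<bar> \<partial>M) \<longlonglongrightarrow> 0" by simp
  then show ?thesis using that[OF lim] by (simp add: g_def)
qed

end

section \<open>Slopes of exponential averages of concentrating variables\<close>

lemma exp_le_one_plus_abs:
  fixes y :: real
  assumes "\<bar>y\<bar> \<le> R"
  shows "exp y \<le> 1 + \<bar>y\<bar> * exp R"
proof -
  have "exp y * (1 - y) \<le> exp y * exp (- y)"
    by (intro mult_left_mono) (use exp_ge_add_one_self[of "- y"] in auto)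
  then have "exp y \<le> 1 + y * exp y" by (simp add: algebra_simps flip: exp_add)
  also have "y * exp y \<le> \<bar>y\<bar> * exp R"
    using assms by (intro mult_mono) auto
  finally show ?thesis by simp
qed

text \<open>
  Given \<open>h\<close>, the hypothesis on \<open>F\<close> is used with \<open>n \<approx> M / h\<close>. The exponents \<open>n h (X - \<kappa>)\<close> are then
  uniformly bounded by some \<open>R\<close>, so the average of their exponentials is \<open>1 + O(s n)\<close>, where
  \<open>s n\<close> is the mean deviation of \<open>X\<close> from \<open>\<kappa>\<close>; the constant \<open>C\<close> contributes at most \<open>C / M\<close> per unit
  of \<open>h\<close>.
\<close>

lemma concentration_slope_upper:
  fixes p :: "nat \<Rightarrow> 'w \<Rightarrow> real" and X :: "nat \<Rightarrow> 'w \<Rightarrow> real" and F :: "real \<Rightarrow> real"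
  assumes fin: "\<And>n. finite (W n)"
    and p0: "\<And>n w. w \<in> W n \<Longrightarrow> 0 \<le> p n w" and p1: "\<And>n. n \<ge> 1 \<Longrightarrow> (\<Sum>w\<in>W n. p n w) = 1"
    and X: "\<And>n w. n \<ge> 1 \<Longrightarrow> w \<in> W n \<Longrightarrow> \<bar>X n w\<bar> \<le> B"
    and conc: "(\<lambda>n. \<Sum>w\<in>W n. p n w * \<bar>X n w - \<kappa>\<bar>) \<longlonglongrightarrow> 0"
    and "\<delta> > 0"
    and F: "\<And>n h. n \<ge> 1 \<Longrightarrow> 0 < h \<Longrightarrow> h < \<delta> \<Longrightarrow>
      F h \<le> (ln (\<Sum>w\<in>W n. p n w * exp (real n * h * X n w)) + C) / real n"
    and e: "e > 0"
  shows "\<forall>\<^sub>F h in at_right 0. F h \<le> h * (\<kappa> + e)"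
proof -
  \<comment> \<open>large enough that \<open>(1 + C) / M \<le> e\<close>; the 1 will pay for the deviation of \<open>X\<close> from \<open>\<kappa>\<close>\<close>
  define M where "M = (\<bar>C\<bar> + 1) / e"
  have M: "M > 0" using e by (simp add: M_def)
  define R where "R = (M + 1) * (\<bar>B\<bar> + \<bar>\<kappa>\<bar>)"
  define K where "K = (M + 1) * exp R"
  have K: "K > 0" using M by (simp add: K_def)
  define s where "s n = (\<Sum>w\<in>W n. p n w * \<bar>X n w - \<kappa>\<bar>)" for n
  have s0: "s n \<ge> 0" for n unfolding s_def using p0 by (intro sum_nonneg) auto
  have "\<forall>\<^sub>F n in sequentially. s n < 1 / K"
    using conc K unfolding s_def[symmetric] by (intro order_tendstoD(2)) auto
  then obtain N where N: "\<And>n. n \<ge> N \<Longrightarrow> s n < 1 / K" unfolding eventually_sequentially by blast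
  \<comment> \<open>\<open>h < 1\<close> keeps \<open>n h\<close> below \<open>M + 1\<close>, and \<open>h < M / (N + 1)\<close> makes \<open>n \<approx> M / h\<close> at least \<open>N\<close>\<close>
  define h0 where "h0 = Min {\<delta>, 1, M / (real N + 1)}"
  have h0: "h0 > 0" using \<open>\<delta> > 0\<close> M by (simp add: h0_def)
  have main: "F h \<le> h * (\<kappa> + e)" if h: "0 < h" "h < h0" for h
  proof -
    have h': "h < \<delta>" "h < 1" "h < M / (real N + 1)" using h by (auto simp: h0_def)
    define n where "n = nat \<lceil>M / h\<rceil>"
    have Mh: "M / h > 0" using M h by simp
    have "M / h \<le> real n" unfolding n_def by (rule real_nat_ceiling_ge)
    then have nM: "M \<le> real n * h" using h by (simp add: field_simps)
    have "real n < M / h + 1" unfolding n_def using Mh by linarith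
    then have "real n * h < (M / h + 1) * h" using h by (intro mult_strict_right_mono) auto
    also have "\<dots> = M + h" using h by (simp add: field_simps)
    finally have nM': "real n * h \<le> M + 1" using h' by linarith
    have "real N < M / h" using h h' by (simp add: field_simps)
    then have nN: "n \<ge> N" using \<open>M / h \<le> real n\<close> by linarith
    have n1: "n \<ge> 1" using Mh \<open>M / h \<le> real n\<close> by (cases n) auto
    let ?y = "\<lambda>w. real n * h * (X n w - \<kappa>)"
    have pw: "exp (?y w) \<le> 1 + K * \<bar>X n w - \<kappa>\<bar>" if w: "w \<in> W n" for w
    proof -
      have y: "\<bar>?y w\<bar> \<le> (M + 1) * \<bar>X n w - \<kappa>\<bar>"
        unfolding abs_mult using nM' h by (intro mult_right_mono) auto
      also have "\<dots> \<le> R" unfolding R_def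
        using X[OF n1 w] M by (intro mult_left_mono) auto
      finally have "exp (?y w) \<le> 1 + \<bar>?y w\<bar> * exp R" by (rule exp_le_one_plus_abs)
      also have "\<bar>?y w\<bar> * exp R \<le> (M + 1) * \<bar>X n w - \<kappa>\<bar> * exp R"
        using y by (intro mult_right_mono) auto
      finally show ?thesis by (simp add: K_def ac_simps)
    qed
    have "(\<Sum>w\<in>W n. p n w * exp (?y w)) \<le> (\<Sum>w\<in>W n. p n w * (1 + K * \<bar>X n w - \<kappa>\<bar>))"
      using pw p0 by (intro sum_mono mult_left_mono) auto
    also have "\<dots> = 1 + K * s n"
      using p1[OF n1] by (simp add: s_def sum_distrib_left distrib_left sum.distrib ac_simps)
    finally have le: "(\<Sum>w\<in>W n. p n w * exp (?y w)) \<le> 1 + K * s n" .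
    have "(\<Sum>w\<in>W n. p n w * exp (real n * h * X n w))
        = exp (real n * h * \<kappa>) * (\<Sum>w\<in>W n. p n w * exp (?y w))"
      by (simp add: sum_distrib_left algebra_simps flip: exp_add)
    moreover have pos: "(\<Sum>w\<in>W n. p n w * exp (?y w)) > 0"
    proof -
      have "\<exists>w\<in>W n. p n w \<noteq> 0"
      proof (rule ccontr)
        assume "\<not> ?thesis"
        then have "(\<Sum>w\<in>W n. p n w) = 0" by (intro sum.neutral) auto
        then show False using p1[OF n1] by simp
      qed
      then obtain w where w: "w \<in> W n" "p n w > 0" using p0 by fastforce
      show ?thesis by (rule sum_pos2[OF fin w(1)]) (use w p0 in auto)
    qed
    ultimately have "ln (\<Sum>w\<in>W n. p n w * exp (real n * h * X n w))
        = real n * h * \<kappa> + ln (\<Sum>w\<in>W n. p n w * exp (?y w))"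
      by (simp add: ln_mult)
    also have "ln (\<Sum>w\<in>W n. p n w * exp (?y w)) \<le> K * s n"
      using ln_add_one_self_le_self[of "K * s n"] le pos K s0[of n]
      by (smt (verit) ln_le_cancel_iff mult_nonneg_nonneg)
    also have "K * s n \<le> 1" using N[OF nN] K by (simp add: field_simps less_imp_le)
    finally have "F h \<le> (real n * h * \<kappa> + 1 + C) / real n"
      using F[OF n1 h(1) h'(1)] n1 by (smt (verit) divide_right_mono of_nat_0_le_iff)
    also have "\<dots> = h * \<kappa> + (1 + C) / real n" using n1 by (simp add: add_divide_distrib)
    also have "(1 + C) / real n \<le> h * e"
    proof -
      have "1 + C \<le> M * e" using e by (simp add: M_def)
      also have "\<dots> \<le> real n * h * e" using nM e by (intro mult_right_mono) auto
      finally show ?thesis using n1 by (simp add: field_simps)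
    qed
    finally show ?thesis by (simp add: distrib_left)
  qed
  show ?thesis
    unfolding eventually_at_right_field using h0 main by (intro exI[of _ h0]) auto
qed

text \<open>
  Midpoint convexity turns an upper bound for the increment on one side into a lower bound
  for the increment on the other side.
\<close>

lemma has_real_derivative_of_slope_bounds:
  fixes P :: "real \<Rightarrow> real"
  assumes right: "\<And>e. e > 0 \<Longrightarrow> \<forall>\<^sub>F h in at_right 0. P (t + h) - P t \<le> h * (D + e)"
    and left: "\<And>e. e > 0 \<Longrightarrow> \<forall>\<^sub>F h in at_right 0. P (t - h) - P t \<le> h * (- D + e)"
    and mid: "\<forall>\<^sub>F h in at_right 0. 2 * P t \<le> P (t + h) + P (t - h)"
  shows "(P has_real_derivative D) (at t)"
  unfolding has_field_derivative_iff
proof (rule LIM_I)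
  fix r :: real assume r: "0 < r"
  have r2: "r / 2 > 0" using r by simp
  from right[OF r2] left[OF r2] mid
  have "\<forall>\<^sub>F h in at_right 0. \<bar>P (t + h) - P t - h * D\<bar> \<le> h * (r / 2) \<and> \<bar>P (t - h) - P t + h * D\<bar> \<le> h * (r / 2)"
    by eventually_elim (intro conjI abs_leI; simp add: algebra_simps; linarith)
  then obtain s where s: "s > 0"
    "\<And>h. 0 < h \<Longrightarrow> h < s \<Longrightarrow> \<bar>P (t + h) - P t - h * D\<bar> \<le> h * (r / 2) \<and> \<bar>P (t - h) - P t + h * D\<bar> \<le> h * (r / 2)"
    unfolding eventually_at_right_field by auto
  have "norm ((P x - P t) / (x - t) - D) < r" if x: "x \<noteq> t" "norm (x - t) < s" for x
  proof -
    have "\<bar>P x - P t - (x - t) * D\<bar> \<le> \<bar>x - t\<bar> * (r / 2)"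
    proof (cases "x > t")
      case True then show ?thesis using s(2)[of "x - t"] x by simp
    next
      case False
      then show ?thesis using s(2)[of "t - x"] x by (simp add: algebra_simps)
    qed
    moreover have "(P x - P t) / (x - t) - D = (P x - P t - (x - t) * D) / (x - t)"
      using x by (simp add: field_simps)
    ultimately have "\<bar>(P x - P t) / (x - t) - D\<bar> \<le> r / 2"
      using x by (simp add: abs_divide field_simps)
    then show ?thesis using r by simp
  qed
  then show "\<exists>s>0. \<forall>x. x \<noteq> t \<and> norm (x - t) < s \<longrightarrow> norm ((P x - P t) / (x - t) - D) < r"
    using s(1) by blast
qed

section \<open>Shift-invariant measures and cylinders\<close>

lemma length_initial_word [simp]: "length (initial_word n x) = n"
  by (simp add: initial_word_def)

lemma cylinder_eq: "cylinder w = {x. \<forall>k<length w. x k = w ! k}"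
  using list_eq_iff_nth_eq[of "map x [0..<length w]" w for x]
  by (simp add: cylinder_def initial_word_def)

lemma funpow_left_shift: "(left_shift ^^ m) x = (\<lambda>k. x (m + k))"
  by (induction m arbitrary: x) (auto simp: left_shift_def fun_eq_iff)

lemma initial_word_add:
  "initial_word (m + n) x = initial_word m x @ initial_word n ((left_shift ^^ m) x)"
  by (rule nth_equalityI) (auto simp: initial_word_def funpow_left_shift nth_append)

lemma open_cylinder: "open (cylinder w :: (nat \<Rightarrow> 'i::discrete_topology) set)"
proof -
  have "cylinder w = (\<Inter>k\<in>{..<length w}. (\<lambda>x. x k) -` {w ! k})"
    by (auto simp: cylinder_eq)
  also have "open \<dots>"
    by (intro open_INT ballI open_vimage Topological_Spaces.open_discrete) auto
  finally show ?thesis .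
qed

lemma continuous_left_shift: "continuous_on UNIV (left_shift :: (nat \<Rightarrow> 'i::topological_space) \<Rightarrow> _)"
  unfolding left_shift_def by (intro continuous_on_coordinatewise_then_product) simp

lemma cylinder_subset_open:
  fixes U :: "(nat \<Rightarrow> 'i::discrete_topology) set"
  assumes "open U" "x \<in> U"
  shows "\<exists>n. cylinder (initial_word n x) \<subseteq> U"
proof -
  from product_topology_open_contains_basis[of "\<lambda>_. euclidean" UNIV U x] assms
  obtain X :: "nat \<Rightarrow> 'i set" where
    X: "x \<in> Pi\<^sub>E UNIV X" "finite {i. X i \<noteq> UNIV}" "Pi\<^sub>E UNIV X \<subseteq> U"
    unfolding open_fun_def by auto
  from X(2) obtain n where n: "\<And>i. X i \<noteq> UNIV \<Longrightarrow> i < n"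
    using finite_nat_set_iff_bounded by auto
  have "cylinder (initial_word n x) \<subseteq> Pi\<^sub>E UNIV X"
    using X(1) n by (auto simp: cylinder_eq initial_word_def PiE_iff) (metis UNIV_I)
  with X(3) show ?thesis by blast
qed

lemma finite_words_of_length: "finite (words_of_length (K :: (nat \<Rightarrow> 'i::finite) set) n)"
proof (rule finite_subset)
  show "words_of_length K n \<subseteq> {w. set w \<subseteq> UNIV \<and> length w = n}"
    by (auto simp: words_of_length_def)
qed (rule finite_lists_length_eq, simp)

context
  fixes K :: "(nat \<Rightarrow> 'i::{finite, discrete_topology}) set" and \<mu>
  assumes \<mu>: "\<mu> \<in> invariant_measures K"
begin

lemma sets_eq_borel: "sets \<mu> = sets borel" and space_eq_UNIV: "space \<mu> = UNIV"
  and prob: "prob_space \<mu>"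
  using \<mu> by (auto simp: invariant_measures_def dest: sets_eq_imp_space_eq)

lemma cylinder_measurable: "cylinder w \<in> sets \<mu>"
  using borel_open[OF open_cylinder] by (simp add: sets_eq_borel)

lemma measure_preserving_left_shift: "measure_preserving_system \<mu> left_shift"
proof -
  have meas: "left_shift \<in> \<mu> \<rightarrow>\<^sub>M \<mu>"
    using borel_measurable_continuous_onI[OF continuous_left_shift]
    by (simp cong: measurable_cong_sets add: sets_eq_borel)
  have "distr \<mu> \<mu> left_shift = \<mu>"
  proof (rule measure_eqI)
    fix B assume "B \<in> sets (distr \<mu> \<mu> left_shift)"
    then show "emeasure (distr \<mu> \<mu> left_shift) B = emeasure \<mu> B"
      using \<mu> meas
      by (subst emeasure_distr) (auto simp: invariant_measures_def space_eq_UNIV)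
  qed simp
  then show ?thesis
    unfolding measure_preserving_system_def measure_preserving_system_axioms_def
    using prob meas by simp
qed

text \<open>
  Such a cylinder misses \<open>K\<close>, hence also the support of \<open>\<mu>\<close>. It is covered by null cylinders,
  of which there are only countably many.
\<close>

lemma measure_cylinder_eq_0:
  assumes w: "w \<notin> words_of_length K (length w)"
  shows "measure \<mu> (cylinder w) = 0"
proof -
  define N where "N = {v. cylinder v \<in> null_sets \<mu>}"
  have "countable N"
    by (rule countable_subset[of _ "lists UNIV"]) (auto intro: countable_lists uncountable_infinite)
  then have null: "(\<Union>v\<in>N. cylinder v) \<in> null_sets \<mu>"
    by (intro null_sets_UN') (auto simp: N_def)
  have "cylinder w \<subseteq> (\<Union>v\<in>N. cylinder v)"
  proof
    fix x assume x: "x \<in> cylinder w"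
    then have "initial_word (length w) x = w" by (simp add: cylinder_def)
    then have "x \<notin> K" using w unfolding words_of_length_def by (metis imageI)
    then have "x \<notin> measure_support \<mu>" using \<mu> by (auto simp: invariant_measures_def)
    then obtain U where U: "open U" "x \<in> U" "emeasure \<mu> U = 0"
      by (auto simp: measure_support_def)
    obtain n where n: "cylinder (initial_word n x) \<subseteq> U"
      using cylinder_subset_open[OF U(1,2)] by blast
    have "U \<in> null_sets \<mu>" using U by (intro null_setsI) (simp_all add: sets_eq_borel)
    then have "initial_word n x \<in> N"
      using null_sets_subset[OF _ cylinder_measurable n] by (simp add: N_def)
    moreover have "x \<in> cylinder (initial_word n x)" by (simp add: cylinder_def)
    ultimately show "x \<in> (\<Union>v\<in>N. cylinder v)" by blast
  qed
  then have "cylinder w \<in> null_sets \<mu>" by (rule null_sets_subset[OF null cylinder_measurable])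
  then show ?thesis by (simp add: measure_eq_0_null_sets)
qed

lemma initial_word_eq_sum:
  fixes g :: "'i list \<Rightarrow> real"
  shows "g (initial_word n x) = (\<Sum>w\<in>{w. length w = n}. g w * indicator (cylinder w) x)"
proof -
  have fin: "finite {w::'i list. length w = n}"
    using finite_lists_length_eq[of "UNIV :: 'i set" n] by simp
  have "(\<Sum>w\<in>{w. length w = n}. g w * indicator (cylinder w) x)
      = (\<Sum>w\<in>{w. length w = n}. if w = initial_word n x then g w else 0)"
    by (intro sum.cong refl) (auto simp: cylinder_def)
  then show ?thesis using fin by simp
qed

lemma initial_word_measurable: "(\<lambda>x. g (initial_word n x) :: real) \<in> borel_measurable \<mu>"
  unfolding initial_word_eq_sum[of g] using cylinder_measurable by measurable

lemma integral_initial_word: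
  fixes g :: "'i list \<Rightarrow> real"
  shows "(\<integral>x. g (initial_word n x) \<partial>\<mu>) = (\<Sum>w\<in>words_of_length K n. measure \<mu> (cylinder w) * g w)"
proof -
  interpret prob_space \<mu> by (rule prob)
  have fin: "finite {w::'i list. length w = n}"
    using finite_lists_length_eq[of "UNIV :: 'i set" n] by simp
  have int: "integrable \<mu> (\<lambda>x. g w * indicator (cylinder w) x)" for w
    by (intro integrable_mult_right integrable_real_indicator)
      (simp_all add: cylinder_measurable emeasure_eq_measure)
  have "(\<integral>x. g (initial_word n x) \<partial>\<mu>) = (\<Sum>w\<in>{w. length w = n}. \<integral>x. g w * indicator (cylinder w) x \<partial>\<mu>)"
    unfolding initial_word_eq_sum[of g] by (rule Bochner_Integration.integral_sum[OF int])
  also have "\<dots> = (\<Sum>w\<in>{w. length w = n}. g w * measure \<mu> (cylinder w))"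
    by (simp add: space_eq_UNIV)
  also have "\<dots> = (\<Sum>w\<in>words_of_length K n. g w * measure \<mu> (cylinder w))"
  proof (rule sum.mono_neutral_right[OF fin])
    show "words_of_length K n \<subseteq> {w. length w = n}" by (auto simp: words_of_length_def)
    show "\<forall>w\<in>{w. length w = n} - words_of_length K n. g w * measure \<mu> (cylinder w) = 0"
      using measure_cylinder_eq_0 by auto
  qed
  finally show ?thesis by (simp add: mult.commute)
qed

lemma sum_measure_cylinder: "(\<Sum>w\<in>words_of_length K n. measure \<mu> (cylinder w)) = 1"
proof -
  interpret prob_space \<mu> by (rule prob)
  show ?thesis using integral_initial_word[of "\<lambda>_. 1" n] by (simp add: prob_space)
qed

end

text \<open>
  Sums over words of \<open>K\<close> weighted by cylinder measures are integrals of functions of the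
  initial word, and a subadditive function of words is a subadditive process along the
  shift.
\<close>

lemma cocycle_mean_convergence:
  fixes K :: "(nat \<Rightarrow> 'i::{finite, discrete_topology}) set" and p :: "'i list \<Rightarrow> real"
  assumes \<mu>: "\<mu> \<in> ergodic_measures K"
    and sub: "\<And>u v. p (u @ v) \<le> p u + p v" and bound: "\<And>w. \<bar>p w\<bar> \<le> C * real (length w)"
  obtains L where
    "(\<lambda>n. (\<Sum>w\<in>words_of_length K n. measure \<mu> (cylinder w) * p w) / real n) \<longlonglongrightarrow> L"
    "(\<lambda>n. \<Sum>w\<in>words_of_length K n. measure \<mu> (cylinder w) * \<bar>p w / real n - L\<bar>) \<longlonglongrightarrow> 0"
proof -
  have inv: "\<mu> \<in> invariant_measures K" using \<mu> by (simp add: ergodic_measures_def)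
  interpret measure_preserving_system \<mu> left_shift
    by (rule measure_preserving_left_shift[OF inv])
  interpret subadditive_process \<mu> left_shift "\<lambda>n x. p (initial_word n x)" C
  proof
    fix B assume "B \<in> sets \<mu>" "left_shift -` B \<inter> space \<mu> = B"
    then have "emeasure \<mu> B = 0 \<or> emeasure \<mu> B = 1"
      using \<mu> by (simp add: ergodic_measures_def sets_eq_borel[OF inv] space_eq_UNIV[OF inv])
    then show "prob B = 0 \<or> prob B = 1" by (auto simp: emeasure_eq_measure)
  next
    fix n show "random_variable borel (\<lambda>x. p (initial_word n x))"
      by (rule initial_word_measurable[OF inv])
  next
    fix n x show "\<bar>p (initial_word n x)\<bar> \<le> C * real n" using bound[of "initial_word n x"] by simp
  next
    fix m n x
    show "p (initial_word (m + n) x) \<le> p (initial_word m x) + p (initial_word n ((left_shift ^^ m) x))"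
      by (simp add: initial_word_add sub)
  qed
  obtain L where L: "(\<lambda>n. (\<integral>x. p (initial_word n x) \<partial>\<mu>) / real n) \<longlonglongrightarrow> L"
    "(\<lambda>n. \<integral>x. \<bar>p (initial_word n x) / real n - L\<bar> \<partial>\<mu>) \<longlonglongrightarrow> 0"
    by (rule subadditive_mean_convergence)
  have "(\<integral>x. \<bar>p (initial_word n x) / real n - L\<bar> \<partial>\<mu>)
      = (\<Sum>w\<in>words_of_length K n. measure \<mu> (cylinder w) * \<bar>p w / real n - L\<bar>)" for n
    by (rule integral_initial_word[OF inv])
  then show ?thesis using that[of L] L by (simp add: integral_initial_word[OF inv])
qed

section \<open>Pressure of a pair of subadditive functions on words\<close>

definition partition_sum :: "(nat \<Rightarrow> 'i) set \<Rightarrow> ('i list \<Rightarrow> real) \<Rightarrow> nat \<Rightarrow> real" where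
  "partition_sum K g n = (\<Sum>w\<in>words_of_length K n. exp (g w))"

lemma words_of_length_length: "w \<in> words_of_length K n \<Longrightarrow> length w = n"
  by (auto simp: words_of_length_def)

lemma words_of_length_nonempty: "K \<noteq> {} \<Longrightarrow> words_of_length K n \<noteq> {}"
  by (simp add: words_of_length_def)

lemma funpow_left_shift_mem:
  assumes "left_shift ` K \<subseteq> K" "x \<in> K" shows "(left_shift ^^ m) x \<in> K"
  using assms by (induction m) auto

lemma partition_sum_pos:
  assumes "K \<noteq> {}" shows "0 < partition_sum (K :: (nat \<Rightarrow> 'i::finite) set) g n"
  unfolding partition_sum_def
  by (rule sum_pos[OF finite_words_of_length words_of_length_nonempty[OF assms]]) simp

text \<open>
  Cutting a word of \<open>K\<close> after \<open>m\<close> letters gives two words of \<open>K\<close>, because \<open>K\<close> is mapped into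
  itself by the shift.
\<close>

lemma partition_sum_submultiplicative:
  fixes K :: "(nat \<Rightarrow> 'i::finite) set"
  assumes K: "left_shift ` K \<subseteq> K" and sub: "\<And>u v. g (u @ v) \<le> g u + g v"
  shows "partition_sum K g (m + n) \<le> partition_sum K g m * partition_sum K g n"
proof -
  let ?W = "words_of_length K"
  let ?cut = "\<lambda>w. (take m w, drop m w)"
  have "partition_sum K g (m + n) \<le> (\<Sum>w\<in>?W (m + n). exp (g (take m w)) * exp (g (drop m w)))"
    unfolding partition_sum_def
  proof (rule sum_mono)
    fix w show "exp (g w) \<le> exp (g (take m w)) * exp (g (drop m w))"
      using sub[of "take m w" "drop m w"] by (simp flip: exp_add)
  qed
  also have "\<dots> = (\<Sum>(u, v)\<in>?cut ` ?W (m + n). exp (g u) * exp (g v))"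
  proof -
    have "inj_on ?cut (?W (m + n))" by (rule inj_on_inverseI[of _ "\<lambda>(u, v). u @ v"]) simp
    then show ?thesis by (simp add: sum.reindex)
  qed
  also have "\<dots> \<le> (\<Sum>(u, v)\<in>?W m \<times> ?W n. exp (g u) * exp (g v))"
  proof (rule sum_mono2)
    show "?cut ` ?W (m + n) \<subseteq> ?W m \<times> ?W n"
      using funpow_left_shift_mem[OF K] by (auto simp: words_of_length_def initial_word_add)
  qed (auto simp: finite_words_of_length)
  also have "\<dots> = partition_sum K g m * partition_sum K g n"
    by (simp add: partition_sum_def sum_product sum.cartesian_product)
  finally show ?thesis .
qed

lemma partition_sum_growth:
  fixes K :: "(nat \<Rightarrow> 'i::finite) set"
  assumes K: "K \<noteq> {}" "left_shift ` K \<subseteq> K" and sub: "\<And>u v. g (u @ v) \<le> g u + g v"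
    and bound: "\<And>w. \<bar>g w\<bar> \<le> C * real (length w)"
  shows "(\<lambda>n. ln (partition_sum K g n) / real n) \<longlonglongrightarrow> lim (\<lambda>n. ln (partition_sum K g n) / real n)"
    and "n \<ge> 1 \<Longrightarrow> real n * lim (\<lambda>n. ln (partition_sum K g n) / real n) \<le> ln (partition_sum K g n)"
proof -
  have pos: "0 < partition_sum K g n" for n by (rule partition_sum_pos[OF K(1)])
  have "ln (partition_sum K g (m + n)) \<le> ln (partition_sum K g m) + ln (partition_sum K g n)" for m n
  proof -
    have "ln (partition_sum K g (m + n)) \<le> ln (partition_sum K g m * partition_sum K g n)"
      by (rule ln_mono[OF partition_sum_submultiplicative[OF K(2) sub] pos])
    then show ?thesis using pos[of m] pos[of n] by (simp add: ln_mult)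
  qed
  moreover have "- C * real n \<le> ln (partition_sum K g n)" for n
  proof -
    obtain w where w: "w \<in> words_of_length K n" using words_of_length_nonempty[OF K(1)] by blast
    have "exp (g w) \<le> partition_sum K g n"
      unfolding partition_sum_def by (rule member_le_sum[OF w]) (auto simp: finite_words_of_length)
    then have "g w \<le> ln (partition_sum K g n)" by (metis exp_gt_zero ln_exp ln_mono)
    then show ?thesis using bound[of w] words_of_length_length[OF w] by (simp add: abs_le_iff)
  qed
  ultimately obtain L where L: "(\<lambda>n. ln (partition_sum K g n) / real n) \<longlonglongrightarrow> L"
    "\<And>n. n \<ge> 1 \<Longrightarrow> L \<le> ln (partition_sum K g n) / real n"
    using fekete_subadditive[of "\<lambda>n. ln (partition_sum K g n)" C] by blast
  have "lim (\<lambda>n. ln (partition_sum K g n) / real n) = L" using L(1) by (rule limI)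
  then show "(\<lambda>n. ln (partition_sum K g n) / real n) \<longlonglongrightarrow> lim (\<lambda>n. ln (partition_sum K g n) / real n)"
    and "n \<ge> 1 \<Longrightarrow> real n * lim (\<lambda>n. ln (partition_sum K g n) / real n) \<le> ln (partition_sum K g n)"
    using L by (simp_all add: field_simps)
qed

text \<open>
  After taking logarithms this is midpoint convexity in the direction \<open>d\<close>; it passes to the
  limit, where it becomes midpoint convexity of the pressure.
\<close>

lemma partition_sum_midpoint:
  fixes K :: "(nat \<Rightarrow> 'i::finite) set"
  shows "(partition_sum K g n)\<^sup>2 \<le> partition_sum K (\<lambda>w. g w + d w) n * partition_sum K (\<lambda>w. g w - d w) n"
proof -
  let ?a = "\<lambda>w. exp ((g w + d w) / 2)" and ?b = "\<lambda>w. exp ((g w - d w) / 2)"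
  have "(\<Sum>w\<in>words_of_length K n. ?a w * ?b w)\<^sup>2
      \<le> (\<Sum>w\<in>words_of_length K n. (?a w)\<^sup>2) * (\<Sum>w\<in>words_of_length K n. (?b w)\<^sup>2)"
    by (rule Cauchy_Schwarz_ineq_sum)
  moreover have "?a w * ?b w = exp (g w)" for w by (simp add: field_simps flip: exp_add)
  moreover have "(?a w)\<^sup>2 = exp (g w + d w)" "(?b w)\<^sup>2 = exp (g w - d w)" for w
    by (simp_all add: field_simps flip: exp_double)
  ultimately show ?thesis by (simp add: partition_sum_def)
qed

text \<open>
  The core of the argument, for the interpolation \<open>(1 - \<theta>) p + \<theta> q\<close> of two subadditive
  functions on words. Only the parameter \<open>\<theta>\<close> at which the derivative is taken enters the
  lower bound for \<open>\<mu>\<close>.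
\<close>

theorem gibbs_pressure_derivative:
  fixes K :: "(nat \<Rightarrow> 'i::{finite, discrete_topology}) set" and p q :: "'i list \<Rightarrow> real"
  defines "P \<equiv> \<lambda>\<theta>. lim (\<lambda>n. ln (partition_sum K (\<lambda>w. (1 - \<theta>) * p w + \<theta> * q w) n) / real n)"
  assumes K: "K \<noteq> {}" "left_shift ` K \<subseteq> K"
    and subp: "\<And>u v. p (u @ v) \<le> p u + p v" and subq: "\<And>u v. q (u @ v) \<le> q u + q v"
    and boundp: "\<And>w. \<bar>p w\<bar> \<le> C * real (length w)" and boundq: "\<And>w. \<bar>q w\<bar> \<le> C * real (length w)"
    and \<mu>: "\<mu> \<in> ergodic_measures K"
    and \<theta>: "0 < \<theta>" "\<theta> < 1" and c: "c \<ge> 1"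
    and gibbs: "\<And>n w. n \<ge> 1 \<Longrightarrow> w \<in> words_of_length K n \<Longrightarrow>
      inverse c * exp (- real n * P \<theta>) * exp ((1 - \<theta>) * p w + \<theta> * q w) \<le> measure \<mu> (cylinder w)"
  shows "(P has_real_derivative
      lim (\<lambda>n. (\<Sum>w\<in>words_of_length K n. measure \<mu> (cylinder w) * (q w - p w)) / real n)) (at \<theta>)"
proof -
  let ?W = "words_of_length K"
  define G where "G s w = (1 - s) * p w + s * q w" for s w
  define Z where "Z s n = partition_sum K (G s) n" for s n
  define r where "r w = q w - p w" for w
  have P: "P s = lim (\<lambda>n. ln (Z s n) / real n)" for s by (simp add: P_def Z_def G_def[abs_def])
  have inv: "\<mu> \<in> invariant_measures K" using \<mu> by (simp add: ergodic_measures_def)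
  have fin: "finite (?W n)" for n by (rule finite_words_of_length)
  have Zpos: "0 < Z s n" for s n unfolding Z_def by (rule partition_sum_pos[OF K(1)])
  have Gsub: "G s (u @ v) \<le> G s u + G s v" if "0 < s" "s < 1" for s u v
  proof -
    have "G s (u @ v) \<le> (1 - s) * (p u + p v) + s * (q u + q v)"
      unfolding G_def using that subp subq by (intro add_mono mult_left_mono) auto
    then show ?thesis by (simp add: G_def algebra_simps)
  qed
  have Gbound: "\<bar>G s w\<bar> \<le> C * real (length w)" if "0 < s" "s < 1" for s w
  proof -
    have "\<bar>G s w\<bar> \<le> (1 - s) * \<bar>p w\<bar> + s * \<bar>q w\<bar>"
      unfolding G_def using that by (intro order_trans[OF abs_triangle_ineq]) (simp add: abs_mult)
    also have "\<dots> \<le> (1 - s) * (C * real (length w)) + s * (C * real (length w))"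
      using that boundp boundq by (intro add_mono mult_left_mono) auto
    finally show ?thesis by (simp add: algebra_simps)
  qed
  have lim: "(\<lambda>n. ln (Z s n) / real n) \<longlonglongrightarrow> P s" if "0 < s" "s < 1" for s
    unfolding P unfolding Z_def by (rule partition_sum_growth(1)[OF K Gsub[OF that] Gbound[OF that]])
  have inf: "real n * P s \<le> ln (Z s n)" if "0 < s" "s < 1" "n \<ge> 1" for s n
    unfolding P unfolding Z_def
    by (rule partition_sum_growth(2)[OF K Gsub[OF that(1,2)] Gbound[OF that(1,2)] that(3)])
  have gibbs': "exp (G \<theta> w) \<le> c * exp (real n * P \<theta>) * measure \<mu> (cylinder w)"
    if "n \<ge> 1" "w \<in> ?W n" for n w
    using gibbs[OF that] c by (simp add: G_def exp_minus field_simps)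
  have Zupper: "ln (Z \<theta> n) \<le> real n * P \<theta> + ln c" if n: "n \<ge> 1" for n
  proof -
    have "Z \<theta> n \<le> (\<Sum>w\<in>?W n. c * exp (real n * P \<theta>) * measure \<mu> (cylinder w))"
      unfolding Z_def partition_sum_def using gibbs'[OF n] by (intro sum_mono)
    also have "\<dots> = c * exp (real n * P \<theta>)"
      by (simp add: sum_measure_cylinder[OF inv] flip: sum_distrib_left)
    finally have "ln (Z \<theta> n) \<le> ln (c * exp (real n * P \<theta>))"
      using Zpos c by (intro ln_mono) auto
    then show ?thesis using c by (simp add: ln_mult)
  qed
  \<comment> \<open>The normalised weights are dominated by \<open>c \<mu>\<close> and inherit the concentration from \<open>\<mu>\<close>.\<close>
  define m where "m n w = exp (G \<theta> w) / Z \<theta> n" for n w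
  have m0: "0 \<le> m n w" for n w using Zpos[of \<theta> n] by (simp add: m_def)
  have m1: "(\<Sum>w\<in>?W n. m n w) = 1" for n
  proof -
    have "(\<Sum>w\<in>?W n. m n w) = Z \<theta> n / Z \<theta> n"
      by (simp add: m_def Z_def partition_sum_def flip: sum_divide_distrib)
    then show ?thesis using Zpos[of \<theta> n] by simp
  qed
  have m_le: "m n w \<le> c * measure \<mu> (cylinder w)" if "n \<ge> 1" "w \<in> ?W n" for n w
  proof -
    have "exp (real n * P \<theta>) \<le> Z \<theta> n"
      using inf[OF \<theta> that(1)] Zpos by (metis exp_le_cancel_iff exp_ln)
    then have "c * exp (real n * P \<theta>) * measure \<mu> (cylinder w) \<le> c * Z \<theta> n * measure \<mu> (cylinder w)"
      using c by (intro mult_right_mono mult_left_mono) auto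
    with gibbs'[OF that] have "exp (G \<theta> w) \<le> c * Z \<theta> n * measure \<mu> (cylinder w)" by linarith
    then show ?thesis using Zpos[of \<theta> n] by (simp add: m_def field_simps)
  qed
  obtain Lp where Lp:
    "(\<lambda>n. (\<Sum>w\<in>?W n. measure \<mu> (cylinder w) * p w) / real n) \<longlonglongrightarrow> Lp"
    "(\<lambda>n. \<Sum>w\<in>?W n. measure \<mu> (cylinder w) * \<bar>p w / real n - Lp\<bar>) \<longlonglongrightarrow> 0"
    using cocycle_mean_convergence[OF \<mu> subp boundp] by blast
  obtain Lq where Lq:
    "(\<lambda>n. (\<Sum>w\<in>?W n. measure \<mu> (cylinder w) * q w) / real n) \<longlonglongrightarrow> Lq"
    "(\<lambda>n. \<Sum>w\<in>?W n. measure \<mu> (cylinder w) * \<bar>q w / real n - Lq\<bar>) \<longlonglongrightarrow> 0"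
    using cocycle_mean_convergence[OF \<mu> subq boundq] by blast
  define L where "L = Lq - Lp"
  have "(\<lambda>n. (\<Sum>w\<in>?W n. measure \<mu> (cylinder w) * (q w - p w)) / real n) \<longlonglongrightarrow> L"
    using tendsto_diff[OF Lq(1) Lp(1)]
    by (simp add: L_def right_diff_distrib sum_subtractf diff_divide_distrib)
  then have limL: "lim (\<lambda>n. (\<Sum>w\<in>?W n. measure \<mu> (cylinder w) * (q w - p w)) / real n) = L"
    by (rule limI)
  define X where "X n w = r w / real n" for n w
  have conc: "(\<lambda>n. \<Sum>w\<in>?W n. m n w * \<bar>X n w - L\<bar>) \<longlonglongrightarrow> 0"
  proof (rule tendsto_sandwich[OF _ _ tendsto_const])
    show "\<forall>\<^sub>F n in sequentially. 0 \<le> (\<Sum>w\<in>?W n. m n w * \<bar>X n w - L\<bar>)"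
      using m0 by (intro always_eventually allI sum_nonneg) auto
    show "\<forall>\<^sub>F n in sequentially. (\<Sum>w\<in>?W n. m n w * \<bar>X n w - L\<bar>) \<le>
        c * ((\<Sum>w\<in>?W n. measure \<mu> (cylinder w) * \<bar>q w / real n - Lq\<bar>)
           + (\<Sum>w\<in>?W n. measure \<mu> (cylinder w) * \<bar>p w / real n - Lp\<bar>))"
      using eventually_ge_at_top[of 1]
    proof eventually_elim
      case (elim n)
      have "m n w * \<bar>X n w - L\<bar> \<le> c * measure \<mu> (cylinder w) * (\<bar>q w / real n - Lq\<bar> + \<bar>p w / real n - Lp\<bar>)"
        if "w \<in> ?W n" for w
      proof (rule mult_mono)
        show "m n w \<le> c * measure \<mu> (cylinder w)" by (rule m_le[OF elim that])
        have "X n w - L = (q w / real n - Lq) - (p w / real n - Lp)"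
          by (simp add: X_def r_def L_def diff_divide_distrib)
        then show "\<bar>X n w - L\<bar> \<le> \<bar>q w / real n - Lq\<bar> + \<bar>p w / real n - Lp\<bar>"
          using abs_triangle_ineq4 by metis
      qed (use c in auto)
      then have "(\<Sum>w\<in>?W n. m n w * \<bar>X n w - L\<bar>) \<le>
        (\<Sum>w\<in>?W n. c * measure \<mu> (cylinder w) * (\<bar>q w / real n - Lq\<bar> + \<bar>p w / real n - Lp\<bar>))"
        by (rule sum_mono)
      then show ?case by (simp add: sum_distrib_left sum.distrib distrib_left mult.assoc)
    qed
    show "(\<lambda>n. c * ((\<Sum>w\<in>?W n. measure \<mu> (cylinder w) * \<bar>q w / real n - Lq\<bar>)
           + (\<Sum>w\<in>?W n. measure \<mu> (cylinder w) * \<bar>p w / real n - Lp\<bar>))) \<longlonglongrightarrow> 0"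
      using tendsto_mult_left[OF tendsto_add[OF Lq(2) Lp(2)], of c] by simp
  qed
  have Xbound: "\<bar>X n w\<bar> \<le> 2 * C" if "n \<ge> 1" "w \<in> ?W n" for n w
  proof -
    have "\<bar>r w\<bar> \<le> 2 * C * real n"
      using boundp[of w] boundq[of w] words_of_length_length[OF that(2)] by (simp add: r_def abs_le_iff)
    then show ?thesis using that(1) by (simp add: X_def field_simps)
  qed
  define \<delta> where "\<delta> = min \<theta> (1 - \<theta>)"
  have \<delta>: "\<delta> > 0" using \<theta> by (simp add: \<delta>_def)
  \<comment> \<open>Bound the pressure at \<open>\<theta> + h\<close> from above by its finite stage \<open>n\<close>, and the pressure at \<open>\<theta>\<close>
    from below by the same stage, up to \<open>ln c\<close>.\<close>
  have increment: "P (\<theta> + h) - P \<theta> \<le> (ln (\<Sum>w\<in>?W n. m n w * exp (real n * h * X n w)) + ln c) / real n"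
    if n: "n \<ge> 1" and h: "\<bar>h\<bar> < \<delta>" for n h
  proof -
    have h': "0 < \<theta> + h" "\<theta> + h < 1" using h by (auto simp: \<delta>_def abs_less_iff)
    have "Z (\<theta> + h) n = (\<Sum>w\<in>?W n. exp (G \<theta> w) * exp (h * r w))"
      unfolding Z_def partition_sum_def
      by (intro sum.cong refl) (simp add: G_def r_def algebra_simps flip: exp_add)
    also have "\<dots> = Z \<theta> n * (\<Sum>w\<in>?W n. m n w * exp (real n * h * X n w))"
      using n Zpos[of \<theta> n] by (simp add: m_def X_def sum_distrib_left field_simps)
    finally have eq: "Z (\<theta> + h) n = Z \<theta> n * (\<Sum>w\<in>?W n. m n w * exp (real n * h * X n w))" .
    then have "0 < (\<Sum>w\<in>?W n. m n w * exp (real n * h * X n w))"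
      using Zpos by (metis zero_less_mult_pos)
    then have "ln (Z (\<theta> + h) n) = ln (Z \<theta> n) + ln (\<Sum>w\<in>?W n. m n w * exp (real n * h * X n w))"
      using eq Zpos[of \<theta> n] by (simp add: ln_mult)
    then have "real n * (P (\<theta> + h) - P \<theta>) \<le> ln (\<Sum>w\<in>?W n. m n w * exp (real n * h * X n w)) + ln c"
      using Zupper[OF n] inf[OF h' n] by (simp add: right_diff_distrib)
    then show ?thesis using n by (simp add: field_simps)
  qed
  show ?thesis
    unfolding limL
  proof (rule has_real_derivative_of_slope_bounds)
    fix e :: real assume e: "e > 0"
    show "\<forall>\<^sub>F h in at_right 0. P (\<theta> + h) - P \<theta> \<le> h * (L + e)"
      by (rule concentration_slope_upper[OF fin m0 m1 Xbound conc \<delta> increment e]) auto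
    have conc': "(\<lambda>n. \<Sum>w\<in>?W n. m n w * \<bar>- X n w - - L\<bar>) \<longlonglongrightarrow> 0"
      using conc by (simp add: abs_minus_commute)
    have "P (\<theta> - h) - P \<theta> \<le> (ln (\<Sum>w\<in>?W n. m n w * exp (real n * h * - X n w)) + ln c) / real n"
      if "n \<ge> 1" "0 < h" "h < \<delta>" for n h
      using increment[of n "- h"] that by simp
    then show "\<forall>\<^sub>F h in at_right 0. P (\<theta> - h) - P \<theta> \<le> h * (- L + e)"
      by (intro concentration_slope_upper[OF fin m0 m1 _ conc' \<delta> _ e]) (use Xbound in auto)
  next
    have "2 * P \<theta> \<le> P (\<theta> + h) + P (\<theta> - h)" if h: "0 < h" "h < \<delta>" for h
    proof -
      have h': "0 < \<theta> + h" "\<theta> + h < 1" "0 < \<theta> - h" "\<theta> - h < 1" using h by (auto simp: \<delta>_def)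
      have "2 * ln (Z \<theta> n) \<le> ln (Z (\<theta> + h) n) + ln (Z (\<theta> - h) n)" for n
      proof -
        have "(\<lambda>w. G \<theta> w + h * r w) = G (\<theta> + h)" "(\<lambda>w. G \<theta> w - h * r w) = G (\<theta> - h)"
          by (simp_all add: fun_eq_iff G_def r_def algebra_simps)
        then have "(Z \<theta> n)\<^sup>2 \<le> Z (\<theta> + h) n * Z (\<theta> - h) n"
          using partition_sum_midpoint[of K "G \<theta>" n "\<lambda>w. h * r w"] by (simp add: Z_def)
        then have "ln ((Z \<theta> n)\<^sup>2) \<le> ln (Z (\<theta> + h) n * Z (\<theta> - h) n)"
          using Zpos[of \<theta> n] by (intro ln_mono) auto
        then show ?thesis using Zpos[of \<theta> n] Zpos[of "\<theta> + h" n] Zpos[of "\<theta> - h" n]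
          by (simp add: ln_mult ln_realpow)
      qed
      then have "2 * (ln (Z \<theta> n) / real n) \<le> ln (Z (\<theta> + h) n) / real n + ln (Z (\<theta> - h) n) / real n" for n
        by (simp add: divide_right_mono flip: add_divide_distrib)
      moreover have "(\<lambda>n. 2 * (ln (Z \<theta> n) / real n)) \<longlonglongrightarrow> 2 * P \<theta>"
        by (intro tendsto_intros lim \<theta>)
      moreover have "(\<lambda>n. ln (Z (\<theta> + h) n) / real n + ln (Z (\<theta> - h) n) / real n)
          \<longlonglongrightarrow> P (\<theta> + h) + P (\<theta> - h)"
        by (intro tendsto_intros lim h')
      ultimately show ?thesis by (intro LIMSEQ_le) auto
    qed
    then show "\<forall>\<^sub>F h in at_right 0. 2 * P \<theta> \<le> P (\<theta> + h) + P (\<theta> - h)"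
      unfolding eventually_at_right_field using \<delta> by (intro exI[of _ \<delta>]) auto
  qed
qed

section \<open>The singular value pressure\<close>

lemma word_matrix_append: "word_matrix A (u @ v) = word_matrix A u ** word_matrix A v"
  by (induction u) (simp_all add: word_matrix_def matrix_mul_assoc)

lemma word_matrix_norm_bounds:
  assumes lo: "0 \<le> lo" "\<And>i x. lo * norm x \<le> norm (A i *v x)" and up: "\<And>i x. norm (A i *v x) \<le> norm x"
  shows "lo ^ length w * norm x \<le> norm (word_matrix A w *v x)" "norm (word_matrix A w *v x) \<le> norm x"
proof (induction w arbitrary: x)
  case (Cons i w)
  have W: "word_matrix A (i # w) *v x = A i *v (word_matrix A w *v x)" for x
    by (simp add: word_matrix_def matrix_vector_mul_assoc)
  {
    case 1
    have "lo ^ length (i # w) * norm x \<le> lo * norm (word_matrix A w *v x)"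
      using mult_left_mono[OF Cons.IH(1)[of x] lo(1)] by (simp add: mult.assoc)
    also have "\<dots> \<le> norm (word_matrix A (i # w) *v x)" unfolding W by (rule lo(2))
    finally show ?case .
  next
    case 2
    show ?case unfolding W using up Cons.IH(2) by (rule order_trans)
  }
qed (simp_all add: word_matrix_def)

text \<open>
  Together with the upper bound by 1 this confines all singular values of a product of \<open>n\<close>
  matrices to \<open>[lo\<^sup>n, 1]\<close>, so that their logarithms grow at most linearly.
\<close>

lemma uniform_expansion_lower_bound:
  fixes A :: "'i::finite \<Rightarrow> real^'n^'n"
  assumes "\<And>i. invertible (A i)"
  obtains lo where "0 < lo" "lo \<le> 1" "\<And>i x. lo * norm x \<le> norm (A i *v x)"
proof -
  obtain B where B: "\<And>i. B i ** A i = mat 1" using assms unfolding invertible_def by metis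
  define s where "s = 1 + (\<Sum>i\<in>UNIV. onorm ((*v) (B i)))"
  have nn: "0 \<le> onorm ((*v) (B i))" for i
    by (intro onorm_pos_le matrix_vector_mul_bounded_linear)
  have s1: "s \<ge> 1" using nn by (simp add: s_def sum_nonneg)
  have "1 / s * norm x \<le> norm (A i *v x)" for i x
  proof -
    have "x = B i *v (A i *v x)" by (simp add: matrix_vector_mul_assoc B)
    then have "norm x \<le> onorm ((*v) (B i)) * norm (A i *v x)"
      by (metis onorm matrix_vector_mul_bounded_linear)
    also have "\<dots> \<le> s * norm (A i *v x)"
    proof (rule mult_right_mono)
      have "onorm ((*v) (B i)) \<le> (\<Sum>i\<in>UNIV. onorm ((*v) (B i)))"
        using nn by (intro member_le_sum) auto
      then show "onorm ((*v) (B i)) \<le> s" by (simp add: s_def)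
    qed simp
    finally show ?thesis using s1 by (simp add: field_simps)
  qed
  moreover have "0 < 1 / s" "1 / s \<le> 1" using s1 by simp_all
  ultimately show ?thesis using that by blast
qed

lemma singular_product_Suc:
  "singular_product (Suc k) M = singular_product k M * singular_values M ! k"
  by (simp add: singular_product_def)

lemma singular_value_function_eq_exp:
  fixes M :: "real^'n^'n"
  assumes s: "real l < s" "s < real l + 1" and l: "l < CARD('n)"
    and pos: "\<And>i. i < CARD('n) \<Longrightarrow> 0 < singular_values M ! i"
  shows "singular_value_function s M = exp ((1 - (s - real l)) * ln (singular_product l M)
    + (s - real l) * ln (singular_product (Suc l) M))"
proof -
  have fl: "nat \<lfloor>s\<rfloor> = l" using s by (simp add: floor_eq_iff nat_eq_iff)
  have sC: "s < real CARD('n)" using s l by linarith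
  have psi: "0 < singular_product l M"
    unfolding singular_product_def using l by (intro prod_pos) (auto intro: pos)
  have "(\<Prod>m = 1..l. singular_value m M) = singular_product l M"
    by (simp add: singular_product_def singular_value_def prod.atLeast1_atMost_eq)
  then have "singular_value_function s M
      = singular_product l M * (singular_values M ! l) powr (s - real l)"
    using sC by (simp add: singular_value_function_def fl singular_value_def)
  also have "\<dots> = exp (ln (singular_product l M) + (s - real l) * ln (singular_values M ! l))"
    using psi pos[OF l] by (simp add: exp_add powr_def)
  also have "ln (singular_values M ! l) = ln (singular_product (Suc l) M) - ln (singular_product l M)"
    using psi pos[OF l] by (simp add: singular_product_Suc ln_mult)
  finally show ?thesis by (simp add: algebra_simps)
qed

theorem theorem4p4:
  fixes A :: "'i::{finite, discrete_topology} \<Rightarrow> real^'n^'n"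
    and K :: "(nat \<Rightarrow> 'i) set"
    and \<mu> :: "(nat \<Rightarrow> 'i) measure"
    and \<alpha> t c :: real
  assumes "CARD('i) \<ge> 2"
    and "0 < \<alpha>" and "\<alpha> < 1"
    and "\<And>i. invertible (A i)"
    and "\<And>i. onorm ((*v) (A i)) \<le> \<alpha>"
    and "K \<noteq> {}" and "compact K" and "left_shift ` K \<subseteq> K"
    and "0 < t" and "t < real CARD('n)" and "t \<notin> \<nat>"
    and "c \<ge> 1"
    and "\<mu> \<in> ergodic_measures K"
    and "\<And>w. w \<in> words K \<Longrightarrow>
           measure \<mu> (cylinder w) \<ge>
             inverse c * exp (- real (length w) * pressure A K t) *
             singular_value_function t (word_matrix A w)"
  shows "(pressure A K has_real_derivative lyapunov_exponent A K (nat \<lfloor>t\<rfloor> + 1) \<mu>) (at t)"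
proof -
  define l where "l = nat \<lfloor>t\<rfloor>"
  have lt: "real l \<le> t" "t < real l + 1" using \<open>0 < t\<close> by (auto simp: l_def)
  have "real l \<noteq> t" using \<open>t \<notin> \<nat>\<close> by (metis of_nat_in_Nats)
  with lt have t: "real l < t" "t < real l + 1" by simp_all
  have l: "l < CARD('n)" using t(1) \<open>t < real CARD('n)\<close> by linarith
  obtain lo where lo: "0 < lo" "lo \<le> 1" "\<And>i x. lo * norm x \<le> norm (A i *v x)"
    using uniform_expansion_lower_bound[of A] assms(4) by blast
  have up: "norm (A i *v x) \<le> norm x" for i x
  proof -
    have "norm (A i *v x) \<le> onorm ((*v) (A i)) * norm x"
      by (rule onorm[OF matrix_vector_mul_bounded_linear])
    also have "\<dots> \<le> 1 * norm x"
      using assms(3) assms(5)[of i] by (intro mult_right_mono) auto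
    finally show ?thesis by simp
  qed
  let ?M = "word_matrix A"
  have svlo: "lo ^ length w \<le> singular_values (?M w) ! i" if "i < CARD('n)" for w i
    by (rule singular_value_ge[OF that]) (rule word_matrix_norm_bounds(1)[OF less_imp_le[OF lo(1)] lo(3) up])
  have svup: "singular_values (?M w) ! i \<le> 1" if "i < CARD('n)" for w i
    by (rule singular_value_le[OF that])
      (use word_matrix_norm_bounds(2)[OF less_imp_le[OF lo(1)] lo(3) up] in simp)
  have svpos: "0 < singular_values (?M w) ! i" if "i < CARD('n)" for w i
    using svlo[OF that, of w] lo(1) by (meson less_le_trans zero_less_power)
  \<comment> \<open>At most \<open>d\<close> logarithms of singular values occur, each between \<open>length w * ln lo\<close> and 0.\<close>
  define C where "C = real CARD('n) * - ln lo"
  define p where "p k w = ln (singular_product k (?M w))" for k w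
  have psipos: "0 < singular_product k (?M w)" if "k \<le> CARD('n)" for k w
    unfolding singular_product_def using that by (intro prod_pos) (auto intro: svpos)
  have sub: "p k (u @ v) \<le> p k u + p k v" if k: "k \<le> CARD('n)" for k u v
  proof -
    have "singular_product k (?M (u @ v)) \<le> singular_product k (?M u) * singular_product k (?M v)"
      unfolding word_matrix_append by (rule singular_product_mult_le[OF k]) (auto intro: svpos)
    then have "ln (singular_product k (?M (u @ v))) \<le> ln (singular_product k (?M u) * singular_product k (?M v))"
      using psipos[OF k, of "u @ v"] by (rule ln_mono)
    then show ?thesis
      using psipos[OF k, of u] psipos[OF k, of v] by (simp add: p_def ln_mult)
  qed
  have bound: "\<bar>p k w\<bar> \<le> C * real (length w)" if k: "k \<le> CARD('n)" for k w
  proof -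
    have sv: "\<bar>ln (singular_values (?M w) ! i)\<bar> \<le> real (length w) * - ln lo" if "i < CARD('n)" for i
    proof -
      have "ln (lo ^ length w) \<le> ln (singular_values (?M w) ! i)"
        by (rule ln_mono[OF svlo[OF that]]) (use lo(1) in simp)
      moreover have "ln (singular_values (?M w) ! i) \<le> 0"
        using svup[OF that] svpos[OF that] by simp
      ultimately show ?thesis using lo(1) by (simp add: ln_realpow)
    qed
    have "p k w = (\<Sum>i<k. ln (singular_values (?M w) ! i))"
      unfolding p_def singular_product_def using k svpos by (intro ln_prod) (auto simp: less_imp_neq[THEN not_sym])
    then have "\<bar>p k w\<bar> \<le> (\<Sum>i<k. \<bar>ln (singular_values (?M w) ! i)\<bar>)" by simp
    also have "\<dots> \<le> (\<Sum>i<k. real (length w) * - ln lo)"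
      by (intro sum_mono sv) (use k in auto)
    also have "\<dots> = real k * (real (length w) * - ln lo)" by simp
    also have "\<dots> \<le> real CARD('n) * (real (length w) * - ln lo)"
      using k lo by (intro mult_right_mono) (auto simp: mult_nonneg_nonpos)
    finally show ?thesis by (simp add: C_def mult_ac)
  qed
  let ?P = "\<lambda>\<theta>. lim (\<lambda>n. ln (partition_sum K (\<lambda>w. (1 - \<theta>) * p l w + \<theta> * p (Suc l) w) n) / real n)"
  have phi: "singular_value_function s (?M w) = exp ((1 - (s - real l)) * p l w + (s - real l) * p (Suc l) w)"
    if "real l < s" "s < real l + 1" for s w
    unfolding p_def by (rule singular_value_function_eq_exp[OF that l]) (rule svpos)
  have press: "pressure A K s = ?P (s - real l)" if "real l < s" "s < real l + 1" for s
    unfolding pressure_def partition_sum_def by (simp add: phi[OF that])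
  have lyap: "lyapunov_exponent A K (l + 1) \<mu>
      = lim (\<lambda>n. (\<Sum>w\<in>words_of_length K n. measure \<mu> (cylinder w) * (p (Suc l) w - p l w)) / real n)"
  proof -
    have "ln (singular_value (l + 1) (?M w)) = p (Suc l) w - p l w" for w
      using psipos[of l w] svpos[OF l, of w] l
      by (simp add: p_def singular_product_Suc singular_value_def ln_mult)
    then show ?thesis unfolding lyapunov_exponent_def by simp
  qed
  have "(?P has_real_derivative lyapunov_exponent A K (l + 1) \<mu>) (at (t - real l))"
    unfolding lyap
  proof (rule gibbs_pressure_derivative[where c = c and C = C])
    fix n w assume n: "n \<ge> 1" "w \<in> words_of_length K n"
    then have "w \<in> words K" by (auto simp: words_def)
    from assms(14)[OF this] show "inverse c * exp (- real n * ?P (t - real l)) *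
        exp ((1 - (t - real l)) * p l w + (t - real l) * p (Suc l) w) \<le> measure \<mu> (cylinder w)"
      by (simp add: press[OF t] phi[OF t] words_of_length_length[OF n(2)])
  qed (use assms t l sub bound in auto)
  then have "((\<lambda>s. ?P (s - real l)) has_real_derivative lyapunov_exponent A K (l + 1) \<mu>) (at t)"
    using DERIV_shift[of ?P _ t "- real l"] by simp
  then have "(pressure A K has_real_derivative lyapunov_exponent A K (l + 1) \<mu>) (at t)"
    by (rule has_field_derivative_transform_within_open[where S = "{real l<..<real l + 1}"])
      (use t press in auto)
  then show ?thesis by (simp add: l_def)
qed

end
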